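(* Let $\mathcal{G}$ be a set of $n$-qubit Pauli strings with dynamical Lie algebra $\mathfrak{g}=\langle i\mathcal{G}\rangle_{\rm Lie}$ and let $G=\exp\mathfrak{g}$ be the corresponding compact Lie group with Haar probability measure $\mu_G$. If both $\mathfrak{g}$ and the space of linear symmetries $\{L\in\mathrm{End}(\mathcal H):[L,U]=0\ \forall U\in G\}$ have bases consisting of Pauli strings (up to scalars), then the second-order frame potential $$F_G^{(2)}=\mathbb{E}_{U,V\sim\mu_G}\left[\left|\mathrm{tr}(UV^\dagger)\right|^{4}\right]$$ satisfies $$F_{G}^{(2)}=\#(\text{isolated vertices})\cdot\#(\text{connected components}),$$ where both counts refer to the commutator graph of $\mathcal{G}$.
   Context: $\mathcal H=(\mathbb C^2)^{\otimes n}$, $d=2^n$. A Pauli string is an operator $\sigma_1\otimes\cdots\otimes\sigma_n$ with each $\sigma_i\in\{I,X,Y,Z\}$ (the identity and the Pauli matrices); there are $4^n$ of them. $\langle i\mathcal{G}\rangle_{\rm Lie}$ is the smallest real Lie algebra (under the matrix commutator) containing $\{ip:p\in\mathcal G\}$. The commutator graph of $\mathcal{G}$ is the undirected graph whose vertices are all $4^n$ Pauli strings, with an edge between $p$ and $q$ iff there is $g\in\mathcal{G}$ such that $[g,p]$ is a nonzero scalar multiple of $q$. An isolated vertex is a connected component with exactly one vertex; isolated vertices are also counted among the connected components. *)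

theory Defs
  imports "HOL-Probability.Probability"
begin

text \<open>The qubits are labelled by a finite type \<open>'n\<close>, and the computational basis states of the
  \<open>n\<close>-qubit space by functions \<open>'n \<Rightarrow> 2\<close>. An operator is thus a square complex matrix with rows
  and columns indexed by \<open>'n \<Rightarrow> 2\<close>, of dimension \<open>2 ^ CARD('n)\<close>. In the type \<open>2\<close> the elements are
  \<open>1\<close> and \<open>2 = 0\<close>; they number the entries of \<open>vector [_, _]\<close> in this order.\<close>

type_synonym 'n operator = "complex^('n \<Rightarrow> 2)^('n \<Rightarrow> 2)"

definition cscale :: "complex \<Rightarrow> complex^'m^'k \<Rightarrow> complex^'m^'k" where
  "cscale c A = (\<chi> i j. c * A $ i $ j)"

text \<open>Unprefixed \<open>span\<close>, \<open>independent\<close> and \<open>subspace\<close> refer to real scalars, those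
  prefixed with \<open>cmat\<close> to complex scalars.\<close>

global_interpretation cmat: vector_space "cscale :: complex \<Rightarrow> complex^'m^'k \<Rightarrow> complex^'m^'k"
  by unfold_locales (simp_all add: cscale_def vec_eq_iff algebra_simps)

definition dagger :: "complex^'m^'k \<Rightarrow> complex^'k^'m" where
  "dagger A = (\<chi> i j. cnj (A $ j $ i))"

definition commutator :: "complex^'m^'m \<Rightarrow> complex^'m^'m \<Rightarrow> complex^'m^'m" where
  "commutator A B = A ** B - B ** A"

text \<open>The multiplication \<open>*\<close> on the type of vectors is componentwise, so the library function
  \<open>exp\<close> does not provide the matrix exponential.\<close>

definition matrix_exp :: "complex^'m^'m \<Rightarrow> complex^'m^'m" where
  "matrix_exp A = (\<Sum>k. (1 / fact k) *\<^sub>R (((**) A ^^ k) (mat 1)))"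

datatype pauli = PI | PX | PY | PZ

primrec pauli_matrix :: "pauli \<Rightarrow> complex^2^2" where
  "pauli_matrix PI = vector [vector [1, 0], vector [0, 1]]"
| "pauli_matrix PX = vector [vector [0, 1], vector [1, 0]]"
| "pauli_matrix PY = vector [vector [0, - \<i>], vector [\<i>, 0]]"
| "pauli_matrix PZ = vector [vector [1, 0], vector [0, - 1]]"

text \<open>The entries of a tensor (Kronecker) product are the products of the entries of the factors.\<close>

definition pauli_string :: "('n::finite \<Rightarrow> pauli) \<Rightarrow> 'n operator" where
  "pauli_string s = (\<chi> x y. \<Prod>i\<in>UNIV. pauli_matrix (s i) $ x i $ y i)"

definition pauli_strings :: "'n::finite operator set" where
  "pauli_strings = range pauli_string"

definition pauli_up_to_scalar :: "'n::finite operator \<Rightarrow> bool" where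
  "pauli_up_to_scalar A \<longleftrightarrow> (\<exists>c. \<exists>p\<in>pauli_strings. A = cscale c p)"

definition is_real_lie_algebra :: "(complex^'m^'m) set \<Rightarrow> bool" where
  "is_real_lie_algebra L \<longleftrightarrow> subspace L \<and> (\<forall>A\<in>L. \<forall>B\<in>L. commutator A B \<in> L)"

definition dynamical_lie_algebra :: "(complex^'m^'m) set \<Rightarrow> (complex^'m^'m) set" where
  "dynamical_lie_algebra \<G> = is_real_lie_algebra hull (cscale \<i> ` \<G>)"

definition dynamical_lie_group :: "(complex^'m^'m) set \<Rightarrow> (complex^'m^'m) set" where
  "dynamical_lie_group \<G> = matrix_exp ` dynamical_lie_algebra \<G>"

definition linear_symmetries :: "(complex^'m^'m) set \<Rightarrow> (complex^'m^'m) set" where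
  "linear_symmetries G = {L. \<forall>U\<in>G. commutator L U = 0}"

definition has_real_pauli_basis :: "'n::finite operator set \<Rightarrow> bool" where
  "has_real_pauli_basis V \<longleftrightarrow>
     (\<exists>B. independent B \<and> span B = V \<and> (\<forall>b\<in>B. pauli_up_to_scalar b))"

definition has_complex_pauli_basis :: "'n::finite operator set \<Rightarrow> bool" where
  "has_complex_pauli_basis V \<longleftrightarrow>
     (\<exists>B. cmat.independent B \<and> cmat.span B = V \<and> (\<forall>b\<in>B. pauli_up_to_scalar b))"

text \<open>A measure on the matrix group \<open>G\<close> is represented by its push-forward along the inclusion of
  \<open>G\<close> into the space of all matrices, i.e. by a Borel measure on that space concentrated on \<open>G\<close>.\<close>

definition haar_probability :: "(complex^'m^'m) set \<Rightarrow> (complex^'m^'m) measure \<Rightarrow> bool" where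
  "haar_probability G \<mu> \<longleftrightarrow>
     prob_space \<mu> \<and> sets \<mu> = sets borel \<and> (AE U in \<mu>. U \<in> G) \<and>
     (\<forall>W\<in>G. distr \<mu> borel (\<lambda>U. W ** U) = \<mu>)"

definition frame_potential :: "nat \<Rightarrow> (complex^'m^'m) measure \<Rightarrow> real" where
  "frame_potential t \<mu> =
     (LINT (U, V)|(\<mu> \<Otimes>\<^sub>M \<mu>). cmod (trace (U ** dagger V)) ^ (2 * t))"

definition commutator_edges :: "'n::finite operator set \<Rightarrow> ('n operator \<times> 'n operator) set" where
  "commutator_edges \<G> = {(p, q). p \<in> pauli_strings \<and> q \<in> pauli_strings \<and>
     (\<exists>g\<in>\<G>. \<exists>c. c \<noteq> 0 \<and> commutator g p = cscale c q)}"

text \<open>The converse is included because edges of the commutator graph are undirected.\<close>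

definition same_component :: "'n::finite operator set \<Rightarrow> ('n operator \<times> 'n operator) set" where
  "same_component \<G> = (commutator_edges \<G> \<union> (commutator_edges \<G>)\<inverse>)\<^sup>*"

definition connected_components :: "'n::finite operator set \<Rightarrow> 'n operator set set" where
  "connected_components \<G> = pauli_strings // same_component \<G>"

definition isolated_vertices :: "'n::finite operator set \<Rightarrow> 'n operator set set" where
  "isolated_vertices \<G> = {C \<in> connected_components \<G>. card C = 1}"

end

theory Submission
  imports Defs
begin

text \<open>The numbers \<open>tr (p U q U\<^sup>\<dagger>) / 2\<^sup>n\<close>, for Pauli strings \<open>p\<close> and \<open>q\<close>, are the real matrix coefficients of
  the adjoint representation, and \<open>\<bar>tr (U V\<^sup>\<dagger>)\<bar>\<^sup>2\<close> is the sum over \<open>p\<close>, \<open>q\<close> of the products of the coefficients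
  of \<open>U\<close> and \<open>V\<close>. Hence the frame potential is the sum of \<open>\<bar>K p p' q q'\<bar>\<^sup>2\<close>, where \<open>K p p' q q'\<close> is the Haar
  average of the product of the coefficients at \<open>(p, q)\<close> and \<open>(p', q')\<close>. Up to a phase, \<open>p' = p L\<close> for a
  Pauli string \<open>L\<close>. Invariance under the group elements \<open>\<i> g\<close> and \<open>(1 + \<i> g) / \<surd>2\<close>, with \<open>g\<close> a generator, shows
  that \<open>K p (p L) q q'\<close> vanishes unless \<open>L\<close> commutes with all generators, i.e. is an isolated vertex,
  and that it then depends on \<open>p\<close> only through its connected component \<open>C\<close>. Its sum over \<open>p \<in> C\<close> is the
  average of a constant function, because the conjugations \<open>X \<mapsto> U X U\<^sup>\<dagger>\<close> preserve the span of \<open>C\<close> and fix \<open>L\<close>: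
  it equals \<open>tr (q L q') / 2\<^sup>n\<close> if \<open>q \<in> C\<close> and \<open>0\<close> otherwise. So every pair of an isolated vertex and a
  component contributes \<open>1\<close>.\<close>

section \<open>Complex matrices\<close>

lemma cscale_component [simp]: "cscale c A $ i $ j = c * A $ i $ j"
  by (simp add: cscale_def)

lemma dagger_component [simp]: "dagger A $ i $ j = cnj (A $ j $ i)"
  by (simp add: dagger_def)

lemma cscale_cscale [simp]: "cscale a (cscale b A) = cscale (a * b) A"
  by (simp add: vec_eq_iff)

lemma cscale_one [simp]: "cscale 1 A = A"
  by (simp add: vec_eq_iff)

lemma cscale_zero [simp]: "cscale 0 A = 0" "cscale c 0 = 0"
  by (simp_all add: vec_eq_iff)

lemma cscale_minus: "cscale (- c) A = - cscale c A" "cscale c (- A) = - cscale c A"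
  by (simp_all add: vec_eq_iff)

lemma scaleR_eq_cscale: "r *\<^sub>R A = cscale (of_real r) A"
  unfolding vec_eq_iff vector_scaleR_component cscale_component by (simp add: scaleR_conv_of_real)

lemma cscale_add_right: "cscale c (A + B) = cscale c A + cscale c B"
  by (simp add: vec_eq_iff algebra_simps)

lemma cscale_add_left: "cscale (a + b) A = cscale a A + cscale b A"
  by (simp add: vec_eq_iff algebra_simps)

lemma cscale_diff_right: "cscale c (A - B) = cscale c A - cscale c B"
  by (simp add: vec_eq_iff algebra_simps)

lemma cscale_mult_left [simp]: "cscale c A ** B = cscale c (A ** B)"
  by (simp add: vec_eq_iff matrix_matrix_mult_def sum_distrib_left mult.assoc)

lemma cscale_mult_right [simp]: "A ** cscale c B = cscale c (A ** B)"
  by (simp add: vec_eq_iff matrix_matrix_mult_def sum_distrib_left mult.left_commute)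

lemma matrix_diff_ldistrib: "A ** (B - C) = A ** B - A ** (C :: 'a::ring_1^'k^'m)"
  by (simp add: vec_eq_iff matrix_matrix_mult_def right_diff_distrib sum_subtractf)

lemma matrix_diff_rdistrib: "(A - B) ** C = A ** C - B ** (C :: 'a::ring_1^'k^'m)"
  by (simp add: vec_eq_iff matrix_matrix_mult_def left_diff_distrib sum_subtractf)

lemma matrix_mult_minus_left [simp]: "(- A) ** B = - (A ** (B :: 'a::ring_1^'k^'m))"
  by (simp add: vec_eq_iff matrix_matrix_mult_def sum_negf)

lemma matrix_mult_minus_right [simp]: "A ** (- B) = - (A ** (B :: 'a::ring_1^'k^'m))"
  by (simp add: vec_eq_iff matrix_matrix_mult_def sum_negf)

lemma matrix_mult_zero [simp]: "0 ** A = (0 :: 'a::ring_1^'k^'m)" "A ** 0 = (0 :: 'a::ring_1^'k^'m)"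
  by (simp_all add: vec_eq_iff matrix_matrix_mult_def)

lemma trace_cscale [simp]: "trace (cscale c A) = c * trace A"
  by (simp add: trace_def sum_distrib_left)

lemma trace_zero [simp]: "trace (0 :: 'a::comm_ring_1^'m^'m) = 0"
  by (simp add: trace_def)

lemma trace_minus [simp]: "trace (- A :: 'a::comm_ring_1^'m^'m) = - trace A"
  by (simp add: trace_def sum_negf)

lemma dagger_dagger [simp]: "dagger (dagger A) = A"
  by (simp add: vec_eq_iff)

lemma dagger_mult: "dagger (A ** B) = dagger B ** dagger A"
  by (simp add: vec_eq_iff matrix_matrix_mult_def mult.commute)

lemma dagger_cscale: "dagger (cscale c A) = cscale (cnj c) (dagger A)"
  by (simp add: vec_eq_iff)

lemma dagger_mat_1 [simp]: "dagger (mat 1) = mat 1"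
  by (simp add: vec_eq_iff mat_def)

lemma dagger_add: "dagger (A + B) = dagger A + dagger B"
  by (simp add: vec_eq_iff)

lemma dagger_diff: "dagger (A - B) = dagger A - dagger B"
  by (simp add: vec_eq_iff)

lemma trace_dagger: "trace (dagger A) = cnj (trace A)"
  by (simp add: trace_def)

lemma trace_add: "trace (A + B :: 'a::comm_ring_1^'m^'m) = trace A + trace B"
  by (simp add: trace_def sum.distrib)

lemma trace_diff: "trace (A - B :: 'a::comm_ring_1^'m^'m) = trace A - trace B"
  by (simp add: trace_def sum_subtractf)

lemma dagger_zero [simp]: "dagger 0 = 0"
  by (simp add: vec_eq_iff)

lemma matrix_add_rdistrib: "(A + B) ** C = A ** C + B ** (C :: 'a::ring_1^'k^'m)"
  by (simp add: vec_eq_iff matrix_matrix_mult_def distrib_right sum.distrib)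

lemma cscale_two: "cscale 2 A = A + A"
  using cscale_add_left[of 1 1 A] by simp

lemma anticommute_swap: "A ** B = - (B ** A) \<Longrightarrow> B ** A = - (A ** (B :: 'a::ring_1^'m^'m))"
  by simp

lemma trace_mult: "trace (A ** B) = (\<Sum>i\<in>UNIV. \<Sum>j\<in>UNIV. A $ i $ j * B $ j $ i)"
  by (simp add: trace_def matrix_matrix_mult_def)

section \<open>Pauli strings\<close>

lemma UNIV_pauli: "(UNIV :: pauli set) = {PI, PX, PY, PZ}"
proof -
  have "a \<in> {PI, PX, PY, PZ}" for a
    by (cases a) auto
  then show ?thesis by auto
qed

instance pauli :: finite
  by standard (simp add: UNIV_pauli)

lemma pauli_matrix_hermitian: "dagger (pauli_matrix a) = pauli_matrix a"
  by (cases a) (simp_all add: vec_eq_iff forall_2)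

lemma pauli_matrix_square: "pauli_matrix a ** pauli_matrix a = mat 1"
  by (cases a) (simp_all add: vec_eq_iff forall_2 matrix_matrix_mult_def sum_2 mat_def)

lemma trace_pauli_matrix_mult:
  "trace (pauli_matrix a ** pauli_matrix b) = (if a = b then 2 else 0)"
  by (cases a; cases b) (simp_all add: trace_def matrix_matrix_mult_def sum_2)

lemma pauli_matrix_commute_or_anticommute:
  "\<exists>e\<in>{1, -1}. pauli_matrix a ** pauli_matrix b = cscale e (pauli_matrix b ** pauli_matrix a)"
  by (cases a; cases b) (simp_all add: vec_eq_iff forall_2 matrix_matrix_mult_def sum_2)

lemma pauli_matrix_mult:
  "\<exists>c e. cmod c = 1 \<and> pauli_matrix a ** pauli_matrix b = cscale c (pauli_matrix e)"
proof -
  \<comment> \<open>Both quantifiers range over explicit finite sets, so that the simplifier can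
    decide each of the sixteen cases.\<close>
  have "\<exists>c\<in>{1, \<i>, -\<i>}. \<exists>e\<in>{PI, PX, PY, PZ}. pauli_matrix a ** pauli_matrix b = cscale c (pauli_matrix e)"
    by (cases a; cases b) (simp_all add: vec_eq_iff forall_2 matrix_matrix_mult_def sum_2)
  moreover have "cmod c = 1" if "c \<in> {1, \<i>, -\<i>}" for c
    using that by auto
  ultimately show ?thesis by meson
qed

text \<open>This is the swap identity: the sum of \<sigma> tensor \<sigma> over the four Pauli
  matrices is twice the operator exchanging two qubits.\<close>

lemma pauli_matrix_complete:
  "(\<Sum>a\<in>UNIV. pauli_matrix a $ x $ y * pauli_matrix a $ z $ w) = (if x = w \<and> y = z then 2 else 0)"
  using exhaust_2[of x] exhaust_2[of y] exhaust_2[of z] exhaust_2[of w]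
  by (auto simp: UNIV_pauli)

section \<open>Tensor products over the qubits\<close>

lemma prod_sum_UNIV:
  fixes f :: "'n::finite \<Rightarrow> 'b::finite \<Rightarrow> 'c::comm_semiring_1"
  shows "(\<Prod>i\<in>UNIV. \<Sum>y\<in>UNIV. f i y) = (\<Sum>g\<in>UNIV. \<Prod>i\<in>UNIV. f i (g i))"
  using prod_sum_PiE[of UNIV "\<lambda>_. UNIV" f] by simp

lemma prod_if_zero:
  fixes c :: "'c::comm_semiring_1"
  shows "(\<Prod>i\<in>UNIV. if P (i :: 'n::finite) then c else 0) = (if \<forall>i. P i then c ^ CARD('n) else 0)"
proof (cases "\<forall>i. P i")
  case False
  then have "\<exists>i\<in>UNIV. (if P i then c else 0) = 0" by auto
  then have "(\<Prod>i\<in>UNIV. if P i then c else 0) = 0" by (intro prod_zero) auto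
  then show ?thesis by (subst if_not_P[OF False])
qed simp

text \<open>The factors are arbitrary matrices, because products of Pauli matrices, in which phases
  occur, have to be tensored too.\<close>

definition tensor :: "('n::finite \<Rightarrow> complex^2^2) \<Rightarrow> 'n operator" where
  "tensor f = (\<chi> x y. \<Prod>i\<in>UNIV. f i $ x i $ y i)"

lemma pauli_string_eq_tensor: "pauli_string s = tensor (\<lambda>i. pauli_matrix (s i))"
  by (simp add: pauli_string_def tensor_def)

lemma tensor_mult: "tensor f ** tensor g = tensor (\<lambda>i. f i ** g i)"
  by (simp add: vec_eq_iff tensor_def matrix_matrix_mult_def prod_sum_UNIV prod.distrib)

lemma trace_tensor: "trace (tensor f) = (\<Prod>i\<in>UNIV. trace (f i))"
  by (simp add: trace_def tensor_def prod_sum_UNIV)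

lemma dagger_tensor: "dagger (tensor f) = tensor (\<lambda>i. dagger (f i))"
  by (simp add: vec_eq_iff tensor_def)

lemma tensor_cscale: "tensor (\<lambda>i. cscale (c i) (f i)) = cscale (\<Prod>i\<in>UNIV. c i) (tensor f)"
  by (simp add: vec_eq_iff tensor_def prod.distrib)

lemma tensor_mat_1: "tensor (\<lambda>_ :: 'n::finite. mat 1) = mat 1"
proof -
  have "(\<Prod>i\<in>UNIV. (mat 1 :: complex^2^2) $ x i $ y i) = (if x = y then 1 else 0)" for x y :: "'n::finite \<Rightarrow> 2"
    using prod_if_zero[of "\<lambda>i. x i = y i" "1 :: complex"] by (simp add: mat_def fun_eq_iff)
  then show ?thesis
    unfolding vec_eq_iff tensor_def by (simp add: mat_def)
qed

text \<open>A sum over strings of a product over qubits is a product over qubits of sums over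
  letters, to which \<open>pauli_matrix_complete\<close> applies. Both
  \<open>sum_pauli_trace_mult\<close> and \<open>sum_pauli_conjugation\<close> rest on this
  identity.\<close>

lemma pauli_string_complete:
  fixes x y z w :: "'n::finite \<Rightarrow> 2"
  shows "(\<Sum>s\<in>UNIV. pauli_string s $ x $ y * pauli_string s $ z $ w)
    = (if x = w \<and> y = z then 2 ^ CARD('n) else 0)"
proof -
  have "(\<Sum>s\<in>UNIV. pauli_string s $ x $ y * pauli_string s $ z $ w)
     = (\<Prod>i\<in>UNIV. if x i = w i \<and> y i = z i then 2 else 0)"
    using prod_sum_UNIV[of "\<lambda>i a. pauli_matrix a $ x i $ y i * pauli_matrix a $ z i $ w i"]
    by (simp add: pauli_string_def pauli_matrix_complete prod.distrib)
  also have "\<dots> = (if x = w \<and> y = z then 2 ^ CARD('n) else 0)"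
    by (simp add: prod_if_zero fun_eq_iff)
  finally show ?thesis .
qed

lemma trace_pauli_string_mult:
  fixes s t :: "'n::finite \<Rightarrow> pauli"
  shows "trace (pauli_string s ** pauli_string t) = (if s = t then 2 ^ CARD('n) else 0)"
proof -
  have "trace (pauli_string s ** pauli_string t) = (\<Prod>i\<in>UNIV. if s i = t i then 2 else 0)"
    by (simp add: pauli_string_eq_tensor tensor_mult trace_tensor trace_pauli_matrix_mult)
  also have "\<dots> = (if s = t then 2 ^ CARD('n) else 0)"
    by (simp add: prod_if_zero fun_eq_iff)
  finally show ?thesis .
qed

lemma inj_pauli_string: "inj (pauli_string :: ('n::finite \<Rightarrow> pauli) \<Rightarrow> _)"
proof (rule injI)
  fix s t :: "'n \<Rightarrow> pauli"
  assume "pauli_string s = pauli_string t"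
  then have "trace (pauli_string s ** pauli_string s) = trace (pauli_string s ** pauli_string t)"
    by simp
  then show "s = t"
    by (auto simp: trace_pauli_string_mult split: if_splits)
qed

lemma finite_pauli_strings [simp]: "finite pauli_strings"
  by (simp add: pauli_strings_def)

lemma pauli_strings_complete:
  fixes x y z w :: "'n::finite \<Rightarrow> 2"
  shows "(\<Sum>p\<in>pauli_strings. p $ x $ y * p $ z $ w) = (if x = w \<and> y = z then 2 ^ CARD('n) else 0)"
  unfolding pauli_strings_def
  by (subst sum.reindex[OF inj_pauli_string]) (use pauli_string_complete[of x y z w] in simp)

lemma trace_pauli_mult:
  fixes p q :: "'n::finite operator"
  assumes "p \<in> pauli_strings" "q \<in> pauli_strings"
  shows "trace (p ** q) = (if p = q then 2 ^ CARD('n) else 0)"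
  using assms inj_pauli_string[THEN inj_eq] by (auto simp: pauli_strings_def trace_pauli_string_mult)

lemma pauli_hermitian: "p \<in> pauli_strings \<Longrightarrow> dagger p = p"
  by (auto simp: pauli_strings_def pauli_string_eq_tensor dagger_tensor pauli_matrix_hermitian)

lemma pauli_square: "p \<in> pauli_strings \<Longrightarrow> p ** p = mat 1"
  by (auto simp: pauli_strings_def pauli_string_eq_tensor tensor_mult pauli_matrix_square tensor_mat_1)

lemma pauli_nonzero: "p \<in> pauli_strings \<Longrightarrow> p \<noteq> 0"
  using trace_pauli_mult[of p p] by auto

text \<open>The phases contributed by the individual qubits multiply to a single phase.\<close>

lemma pauli_mult:
  assumes "p \<in> pauli_strings" "q \<in> pauli_strings"
  obtains c r where "cmod c = 1" "r \<in> pauli_strings" "p ** q = cscale c r"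
proof -
  obtain s t where st: "p = pauli_string s" "q = pauli_string t"
    using assms by (auto simp: pauli_strings_def)
  have "\<forall>i. \<exists>c e. cmod c = 1 \<and> pauli_matrix (s i) ** pauli_matrix (t i) = cscale c (pauli_matrix e)"
    using pauli_matrix_mult by blast
  then obtain c e where ce: "\<And>i. cmod (c i) = 1"
      "\<And>i. pauli_matrix (s i) ** pauli_matrix (t i) = cscale (c i) (pauli_matrix (e i))"
    by metis
  have "p ** q = cscale (\<Prod>i\<in>UNIV. c i) (pauli_string e)"
    by (simp add: st pauli_string_eq_tensor tensor_mult ce tensor_cscale)
  moreover have "cmod (\<Prod>i\<in>UNIV. c i) = 1"
    by (simp add: prod_norm[symmetric] ce)
  ultimately show ?thesis
    using that by (auto simp: pauli_strings_def)
qed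

lemma pauli_commute_or_anticommute:
  assumes "p \<in> pauli_strings" "q \<in> pauli_strings"
  shows "p ** q = q ** p \<or> p ** q = - (q ** p)"
proof -
  obtain s t where st: "p = pauli_string s" "q = pauli_string t"
    using assms by (auto simp: pauli_strings_def)
  have "\<forall>i. \<exists>e. e \<in> {1, -1} \<and> pauli_matrix (s i) ** pauli_matrix (t i)
      = cscale e (pauli_matrix (t i) ** pauli_matrix (s i))"
    using pauli_matrix_commute_or_anticommute by blast
  then obtain e where e: "\<And>i. e i \<in> {1, -1}" "\<And>i. pauli_matrix (s i) ** pauli_matrix (t i)
      = cscale (e i) (pauli_matrix (t i) ** pauli_matrix (s i))"
    by metis
  have "p ** q = cscale (\<Prod>i\<in>UNIV. e i) (q ** p)"
    by (simp add: st pauli_string_eq_tensor tensor_mult e tensor_cscale)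
  moreover have "(\<Prod>i\<in>A. e i) \<in> {1, -1}" for A
  proof (induction A rule: infinite_finite_induct)
    case (insert i A)
    then show ?case using e(1)[of i] by auto
  qed auto
  ultimately show ?thesis
    by (metis cscale_minus(1) cscale_one insertE singletonD)
qed

section \<open>The matrix exponential\<close>

abbreviation matrix_power :: "complex^'m^'m \<Rightarrow> nat \<Rightarrow> complex^'m^'m" where
  "matrix_power A k \<equiv> ((**) A ^^ k) (mat 1)"

lemma matrix_power_Suc_right: "matrix_power A (Suc k) = matrix_power A k ** A"
  by (induction k) (simp_all add: matrix_mul_assoc)

lemma dagger_matrix_power: "dagger (matrix_power A k) = matrix_power (dagger A) k"
proof (induction k)
  case (Suc k)
  have "dagger (matrix_power A (Suc k)) = matrix_power (dagger A) k ** dagger A"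
    using Suc by (simp add: dagger_mult)
  then show ?case by (simp only: matrix_power_Suc_right)
qed simp

lemma matrix_mult_sum_left: "A ** sum f I = (\<Sum>i\<in>I. A ** (f i :: complex^'m^'m))"
  by (induction I rule: infinite_finite_induct) (simp_all add: matrix_add_ldistrib)

lemma matrix_mult_sum_right: "sum f I ** A = (\<Sum>i\<in>I. f i ** (A :: complex^'m^'m))"
  by (induction I rule: infinite_finite_induct) (simp_all add: matrix_add_rdistrib)

lemma cscale_sum: "cscale c (sum f I) = (\<Sum>i\<in>I. cscale c (f i))"
  by (induction I rule: infinite_finite_induct) (simp_all add: cscale_add_right)

lemma matrix_sums_iff:
  fixes f :: "nat \<Rightarrow> complex^'m^'k"
  shows "f sums X \<longleftrightarrow> (\<forall>i j. (\<lambda>n. f n $ i $ j) sums (X $ i $ j))"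
proof
  assume *: "f sums X"
  show "\<forall>i j. (\<lambda>n. f n $ i $ j) sums (X $ i $ j)"
  proof (intro allI)
    fix i j
    have "bounded_linear (\<lambda>A :: complex^'m^'k. A $ i $ j)"
      by (intro bounded_linear_compose[OF bounded_linear_vec_nth] bounded_linear_vec_nth)
    from bounded_linear.sums[OF this *] show "(\<lambda>n. f n $ i $ j) sums (X $ i $ j)" .
  qed
next
  assume *: "\<forall>i j. (\<lambda>n. f n $ i $ j) sums (X $ i $ j)"
  show "f sums X"
    unfolding sums_def
    by (intro vec_tendstoI) (use * in \<open>simp add: sums_def\<close>)
qed

abbreviation exp_term :: "complex^'m^'m \<Rightarrow> nat \<Rightarrow> complex^'m^'m" where
  "exp_term A k \<equiv> cscale (1 / fact k) (matrix_power A k)"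

lemma matrix_power_entry_bound:
  fixes A :: "complex^'m::finite^'m"
  assumes "\<And>i j. cmod (A $ i $ j) \<le> a"
  shows "cmod (matrix_power A k $ i $ j) \<le> (real CARD('m) * a) ^ k"
proof (induction k arbitrary: i j)
  case 0
  then show ?case by (simp add: mat_def)
next
  case (Suc k)
  have "0 \<le> a"
    using assms norm_ge_zero order_trans by blast
  have "cmod (matrix_power A (Suc k) $ i $ j) \<le> (\<Sum>l\<in>UNIV. cmod (A $ i $ l) * cmod (matrix_power A k $ l $ j))"
    by (simp add: matrix_matrix_mult_def sum_norm_le norm_mult)
  also have "\<dots> \<le> (\<Sum>l\<in>(UNIV :: 'm set). a * (real CARD('m) * a) ^ k)"
    by (intro sum_mono mult_mono assms Suc) (use \<open>0 \<le> a\<close> in auto)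
  finally show ?case by (simp add: mult.assoc mult.left_commute)
qed

text \<open>Comparison with the real exponential series at \<open>CARD('m) * a\<close>, where
  \<open>a\<close> bounds the entries. The Cauchy product needs this absolute convergence.\<close>

lemma summable_exp_term:
  fixes A :: "complex^'m::finite^'m"
  shows "summable (\<lambda>k. cmod (exp_term A k $ i $ j))"
proof -
  obtain a where a: "\<And>i j. cmod (A $ i $ j) \<le> a"
    using order_trans[OF Finite_Cartesian_Product.norm_nth_le Finite_Cartesian_Product.norm_nth_le] by blast
  show ?thesis
  proof (rule summable_comparison_test)
    show "summable (\<lambda>k. (1 / fact k) * (real CARD('m) * a) ^ k)"
      using summable_exp[of "real CARD('m) * a"] by (simp add: field_simps)
    show "\<exists>N. \<forall>k\<ge>N. norm (cmod (exp_term A k $ i $ j)) \<le> 1 / fact k * (real CARD('m) * a) ^ k"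
      using matrix_power_entry_bound[OF a]
      by (auto simp: norm_mult norm_divide divide_simps)
  qed
qed

lemma matrix_exp_sums: "exp_term A sums matrix_exp A"
proof -
  have "exp_term A sums (\<chi> i j. \<Sum>k. exp_term A k $ i $ j)"
    unfolding matrix_sums_iff vec_lambda_beta
    by (intro allI summable_sums summable_norm_cancel[OF summable_exp_term])
  moreover have "(1 / fact k) *\<^sub>R matrix_power A k = exp_term A k" for k
    by (simp add: scaleR_eq_cscale)
  ultimately show ?thesis
    by (simp add: matrix_exp_def sums_unique[symmetric])
qed

lemma dagger_matrix_exp: "dagger (matrix_exp A) = matrix_exp (dagger A)"
proof (rule sums_unique2)
  have "(\<lambda>k. cnj (exp_term A k $ j $ i)) sums cnj (matrix_exp A $ j $ i)" for i j
    using matrix_exp_sums[of A] unfolding sums_cnj matrix_sums_iff by blast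
  then have "(\<lambda>k. dagger (exp_term A k)) sums dagger (matrix_exp A)"
    unfolding matrix_sums_iff by simp
  then show "exp_term (dagger A) sums dagger (matrix_exp A)"
    by (simp add: dagger_cscale dagger_matrix_power)
qed (rule matrix_exp_sums)

text \<open>The middle factor \<open>X\<close> is carried along to serve conjugations. Every entry
  is a finite sum of products of absolutely convergent scalar series, so the scalar Cauchy product
  suffices.\<close>

lemma matrix_Cauchy_product:
  fixes a b :: "nat \<Rightarrow> complex^'m::finite^'m"
  assumes "a sums A" "b sums B"
    and sa: "\<And>i j. summable (\<lambda>k. cmod (a k $ i $ j))"
    and sb: "\<And>i j. summable (\<lambda>k. cmod (b k $ i $ j))"
  shows "(\<lambda>m. \<Sum>i\<le>m. a i ** X ** b (m - i)) sums (A ** X ** B)"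
proof -
  have *: "(\<lambda>m. \<Sum>i\<le>m. (a i $ x $ u * X $ u $ v) * b (m - i) $ v $ y)
      sums ((A $ x $ u * X $ u $ v) * B $ v $ y)" for x u v y
  proof -
    have "(\<lambda>k. a k $ x $ u * X $ u $ v) sums (A $ x $ u * X $ u $ v)"
      using assms(1) by (intro sums_mult2) (simp add: matrix_sums_iff)
    moreover have "(\<lambda>k. b k $ v $ y) sums (B $ v $ y)"
      using assms(2) by (simp add: matrix_sums_iff)
    moreover have "summable (\<lambda>k. norm (a k $ x $ u * X $ u $ v))"
      unfolding norm_mult by (intro summable_mult2 sa)
    ultimately show ?thesis
      using Cauchy_product_sums[OF _ sb[of v y], of "\<lambda>k. a k $ x $ u * X $ u $ v"]
      by (simp add: sums_unique[symmetric])
  qed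
  have "(\<lambda>m. \<Sum>v\<in>UNIV. \<Sum>u\<in>UNIV. \<Sum>i\<le>m. (a i $ x $ u * X $ u $ v) * b (m - i) $ v $ y)
      sums ((A ** X ** B) $ x $ y)" for x y
    unfolding matrix_matrix_mult_def vec_lambda_beta sum_distrib_right
    by (intro sums_sum *)
  moreover have "(\<Sum>v\<in>UNIV. \<Sum>u\<in>UNIV. \<Sum>i\<le>m. (a i $ x $ u * X $ u $ v) * b (m - i) $ v $ y)
      = (\<Sum>i\<le>m. a i ** X ** b (m - i)) $ x $ y" for m x y
    unfolding matrix_matrix_mult_def sum_component vec_lambda_beta sum_distrib_right
    by (subst (2) sum.swap, subst sum.swap) simp
  ultimately show ?thesis
    unfolding matrix_sums_iff by simp
qed

section \<open>Conjugation by an exponential as a series of iterated commutators\<close>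

lemma exp_term_Suc: "cscale (of_nat (Suc k)) (exp_term A (Suc k)) = A ** exp_term A k"
    "cscale (of_nat (Suc k)) (exp_term A (Suc k)) = exp_term A k ** A"
proof -
  have *: "of_nat (Suc k) * (1 / fact (Suc k)) = (1 / fact k :: complex)"
    by (simp add: field_simps del: of_nat_Suc)
  show "cscale (of_nat (Suc k)) (exp_term A (Suc k)) = A ** exp_term A k"
    unfolding cscale_cscale * by simp
  show "cscale (of_nat (Suc k)) (exp_term A (Suc k)) = exp_term A k ** A"
    unfolding cscale_cscale * matrix_power_Suc_right by simp
qed

text \<open>The sum is the coefficient of \<open>t ^ m\<close> in the series of exp(tA) X exp(-tA).
  Multiplying the coefficient of degree \<open>m + 1\<close> by \<open>m + 1\<close> amounts to
  differentiating one of the two exponentials, which yields the commutator of \<open>A\<close> with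
  the coefficient of degree \<open>m\<close>.\<close>

lemma exp_term_convolution:
  "(\<Sum>i\<le>m. exp_term A i ** X ** exp_term (- A) (m - i))
    = cscale (1 / fact m) ((commutator A ^^ m) X)" (is "?S m = _")
proof (induction m)
  case 0
  then show ?case by simp
next
  case (Suc m)
  let ?a = "exp_term A" and ?b = "exp_term (- A)"
  \<comment> \<open>The factor \<open>Suc m\<close> is split as \<open>i + (Suc m - i)\<close>, one
    summand for each exponential.\<close>
  have "cscale (of_nat (Suc m)) (?S (Suc m))
    = (\<Sum>i\<le>Suc m. cscale (of_nat i) (?a i ** X ** ?b (Suc m - i))
        + cscale (of_nat (Suc m - i)) (?a i ** X ** ?b (Suc m - i)))"
    unfolding cscale_sum
    by (intro sum.cong refl) (simp only: cscale_add_left[symmetric] of_nat_add[symmetric] atMost_iff le_add_diff_inverse)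
  also have "\<dots> = (\<Sum>i\<le>Suc m. cscale (of_nat i) (?a i ** X ** ?b (Suc m - i)))
      + (\<Sum>i\<le>Suc m. cscale (of_nat (Suc m - i)) (?a i ** X ** ?b (Suc m - i)))"
    by (rule sum.distrib)
  \<comment> \<open>Here the term for \<open>i = 0\<close> vanishes and the index is shifted; in the
    second sum the term for \<open>i = Suc m\<close> vanishes.\<close>
  also have "(\<Sum>i\<le>Suc m. cscale (of_nat i) (?a i ** X ** ?b (Suc m - i)))
      = (\<Sum>i\<le>m. cscale (of_nat (Suc i)) (?a (Suc i)) ** X ** ?b (m - i))"
    by (subst sum.atMost_Suc_shift) (simp del: of_nat_Suc)
  also have "\<dots> = A ** ?S m"
    unfolding exp_term_Suc(1) matrix_mult_sum_left matrix_mul_assoc ..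
  also have "(\<Sum>i\<le>Suc m. cscale (of_nat (Suc m - i)) (?a i ** X ** ?b (Suc m - i)))
      = (\<Sum>i\<le>m. cscale (of_nat (Suc m - i)) (?a i ** X ** ?b (Suc m - i)))"
    by (simp only: sum.atMost_Suc diff_self_eq_0 of_nat_0 cscale_zero add_0_right)
  also have "\<dots> = (\<Sum>i\<le>m. ?a i ** X ** cscale (of_nat (Suc (m - i))) (?b (Suc (m - i))))"
    by (intro sum.cong refl) (simp only: cscale_mult_right Suc_diff_le atMost_iff)
  also have "\<dots> = - (?S m ** A)"
    unfolding exp_term_Suc(2) matrix_mult_sum_right by (simp add: matrix_mul_assoc sum_negf)
  also have "A ** ?S m + - (?S m ** A) = cscale (1 / fact m) ((commutator A ^^ Suc m) X)"
    unfolding Suc.IH by (simp add: commutator_def cscale_diff_right)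
  finally have "cscale (1 / of_nat (Suc m)) (cscale (of_nat (Suc m)) (?S (Suc m)))
      = cscale (1 / of_nat (Suc m)) (cscale (1 / fact m) ((commutator A ^^ Suc m) X))"
    by (rule arg_cong)
  then show ?case
    by (simp add: field_simps del: of_nat_Suc funpow.simps)
qed

text \<open>Hadamard's formula. Through it, properties stable under commutators pass from the Lie
  algebra to the group.\<close>

lemma matrix_exp_conjugation:
  "(\<lambda>m. cscale (1 / fact m) ((commutator A ^^ m) X)) sums (matrix_exp A ** X ** matrix_exp (- A))"
  using matrix_Cauchy_product[OF matrix_exp_sums[of A] matrix_exp_sums[of "- A"] summable_exp_term summable_exp_term]
  unfolding exp_term_convolution .

lemma matrix_exp_conjugation_fixed:
  assumes "commutator A X = 0"
  shows "matrix_exp A ** X ** matrix_exp (- A) = X"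
proof (rule sums_unique2[OF matrix_exp_conjugation])
  have "(commutator A ^^ m) X = 0" if "m \<noteq> 0" for m
    using that
  proof (induction m)
    case (Suc m)
    then show ?case using assms by (cases "m = 0") (auto simp: commutator_def)
  qed simp
  then have "(\<lambda>m. cscale (1 / fact m) ((commutator A ^^ m) X)) = (\<lambda>m. if m = 0 then X else 0)"
    by (auto simp: fun_eq_iff)
  then show "(\<lambda>m. cscale (1 / fact m) ((commutator A ^^ m) X)) sums X"
    using sums_single[of 0 "\<lambda>_. X"] by simp
qed

lemma matrix_exp_inverse: "matrix_exp A ** matrix_exp (- A) = mat 1"
  using matrix_exp_conjugation_fixed[of A "mat 1"] by (simp add: commutator_def)

text \<open>The linear functional \<open>trace (r ** _)\<close> is applied to Hadamard's series term
  by term. Since \<open>pauli_span\<close> is cut out by such functionals, this makes it invariant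
  under conjugation.\<close>

lemma trace_conjugation_zero:
  assumes "\<And>m. trace (r ** (commutator A ^^ m) X) = 0"
  shows "trace (r ** (matrix_exp A ** X ** matrix_exp (- A))) = 0" (is "trace (r ** ?Y) = 0")
proof -
  let ?f = "\<lambda>m. cscale (1 / fact m) ((commutator A ^^ m) X)"
  have "(\<lambda>m. ?f m $ i $ j) sums (?Y $ i $ j)" for i j
    using matrix_exp_conjugation[of A X] unfolding matrix_sums_iff by blast
  then have "(\<lambda>m. \<Sum>i\<in>UNIV. \<Sum>j\<in>UNIV. r $ i $ j * ?f m $ j $ i)
      sums (\<Sum>i\<in>UNIV. \<Sum>j\<in>UNIV. r $ i $ j * ?Y $ j $ i)"
    by (intro sums_sum sums_mult)
  then have "(\<lambda>m. trace (r ** ?f m)) sums trace (r ** ?Y)"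
    by (simp add: trace_def matrix_matrix_mult_def[of r] sum_divide_distrib)
  then show ?thesis
    using assms by (simp add: sums_0 sums_unique2[OF _ sums_0])
qed

text \<open>Euler's formula: even powers of \<open>g\<close> are \<open>mat 1\<close> and odd powers
  are \<open>g\<close>, so the series splits into a cosine and a sine part.\<close>

lemma matrix_exp_involution:
  assumes "g ** g = mat 1"
  shows "matrix_exp (cscale (\<i> * of_real t) g) = cscale (of_real (cos t)) (mat 1) + cscale (\<i> * of_real (sin t)) g"
proof -
  define z where "z = \<i> * complex_of_real t"
  define A where "A = cscale z g"
  \<comment> \<open>The half sum of \<open>z ^ k\<close> and \<open>(- z) ^ k\<close> selects the
    even \<open>k\<close>, the half difference the odd ones.\<close>
  have pow: "matrix_power A k = cscale ((z ^ k + (- z) ^ k) / 2) (mat 1) + cscale ((z ^ k - (- z) ^ k) / 2) g" for k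
  proof (induction k)
    case (Suc k)
    have "matrix_power A (Suc k) = A ** matrix_power A k"
      by simp
    also have "\<dots> = cscale (z * ((z ^ k + (- z) ^ k) / 2)) g + cscale (z * ((z ^ k - (- z) ^ k) / 2)) (mat 1)"
      unfolding Suc.IH by (simp add: A_def matrix_add_ldistrib assms mult.commute)
    also have "z * ((z ^ k + (- z) ^ k) / 2) = (z ^ Suc k - (- z) ^ Suc k) / 2"
      by (simp add: field_simps)
    also have "z * ((z ^ k - (- z) ^ k) / 2) = (z ^ Suc k + (- z) ^ Suc k) / 2"
      by (simp add: field_simps)
    finally show ?case by (simp only: add.commute)
  qed simp
  have e: "(\<lambda>k. w ^ k / fact k) sums exp w" for w :: complex
    using exp_converges[of w] by (simp add: scaleR_conv_of_real field_simps)
  have "(\<lambda>k. (z ^ k / fact k + (- z) ^ k / fact k) / 2 * (mat 1 $ i $ j)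
        + (z ^ k / fact k - (- z) ^ k / fact k) / 2 * g $ i $ j)
      sums ((exp z + exp (- z)) / 2 * (mat 1 $ i $ j) + (exp z - exp (- z)) / 2 * g $ i $ j)" for i j
    by (intro sums_add sums_mult2 sums_diff sums_divide e)
  then have "exp_term A sums (cscale ((exp z + exp (- z)) / 2) (mat 1) + cscale ((exp z - exp (- z)) / 2) g)"
    unfolding matrix_sums_iff pow by (simp add: field_simps)
  from sums_unique2[OF matrix_exp_sums this]
  have "matrix_exp A = cscale ((exp z + exp (- z)) / 2) (mat 1) + cscale ((exp z - exp (- z)) / 2) g" .
  moreover have "(exp z + exp (- z)) / 2 = of_real (cos t)"
    using cos_exp_eq[of "complex_of_real t"] by (simp add: z_def cos_of_real)
  moreover have "(exp z - exp (- z)) / 2 = \<i> * of_real (sin t)"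
    unfolding sin_of_real[symmetric] sin_exp_eq z_def by (simp add: diff_divide_distrib)
  ultimately show ?thesis by (simp add: A_def z_def)
qed

section \<open>The dynamical Lie group and the commutator graph\<close>

text \<open>\<open>component_symmetry_iff\<close> identifies these strings with the isolated
  vertices.\<close>

definition pauli_symmetries :: "'n::finite operator set \<Rightarrow> 'n operator set" where
  "pauli_symmetries \<G> = {L \<in> pauli_strings. \<forall>g\<in>\<G>. g ** L = L ** g}"

text \<open>When the generators are Pauli strings, edges are symmetric by \<open>edge_sym\<close>,
  and a set of Pauli strings is closed in this sense iff it is a union of components.\<close>

definition edge_closed :: "'n::finite operator set \<Rightarrow> 'n operator set \<Rightarrow> bool" where
  "edge_closed \<G> C \<longleftrightarrow> (\<forall>(p, q)\<in>commutator_edges \<G>. q \<in> C \<longrightarrow> p \<in> C)"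

text \<open>The span of \<open>C \<subseteq> pauli_strings\<close>, described through the orthogonality of the Pauli strings.\<close>

definition pauli_span :: "'n::finite operator set \<Rightarrow> 'n operator set" where
  "pauli_span C = {X. \<forall>r\<in>pauli_strings - C. trace (r ** X) = 0}"

lemma pauli_span_add: "X \<in> pauli_span C \<Longrightarrow> Y \<in> pauli_span C \<Longrightarrow> X + Y \<in> pauli_span C"
  by (simp add: pauli_span_def matrix_add_ldistrib trace_add)

lemma pauli_span_diff: "X \<in> pauli_span C \<Longrightarrow> Y \<in> pauli_span C \<Longrightarrow> X - Y \<in> pauli_span C"
  by (simp add: pauli_span_def matrix_diff_ldistrib trace_diff)

lemma pauli_span_cscale: "X \<in> pauli_span C \<Longrightarrow> cscale c X \<in> pauli_span C"
  by (simp add: pauli_span_def)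

lemma pauli_span_base: "q \<in> C \<Longrightarrow> q \<in> pauli_strings \<Longrightarrow> q \<in> pauli_span C"
  by (auto simp: pauli_span_def trace_pauli_mult)

lemma commutator_add: "commutator (A + B) X = commutator A X + commutator B X"
  by (simp add: commutator_def matrix_add_ldistrib matrix_add_rdistrib)

lemma commutator_cscale: "commutator (cscale c A) X = cscale c (commutator A X)"
  by (simp add: commutator_def cscale_diff_right)

lemma commutator_commutator:
  "commutator (commutator A B) X = commutator A (commutator B X) - commutator B (commutator A X)"
  by (simp add: commutator_def matrix_diff_ldistrib matrix_diff_rdistrib matrix_mul_assoc)

lemma commutator_zero [simp]: "commutator A 0 = 0" "commutator 0 A = 0"
  by (simp_all add: commutator_def)

lemma dagger_commutator: "dagger (commutator A B) = commutator (dagger B) (dagger A)"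
  by (simp add: commutator_def dagger_diff dagger_mult)

section \<open>Edges of the commutator graph and the Lie algebra\<close>

context
  fixes \<G> :: "'n::finite operator set"
  assumes generators: "\<G> \<subseteq> pauli_strings"
begin

text \<open>A nonzero commutator forces \<open>g\<close> and \<open>p\<close> to anticommute, so it
  equals twice \<open>g ** p\<close>. The value of \<open>c\<^sup>2\<close> makes the phases cancel
  in \<open>haar_coeff_edge\<close>.\<close>

lemma edgeE:
  assumes "(p, q) \<in> commutator_edges \<G>"
  obtains g c where "g \<in> \<G>" "g ** p = - (p ** g)" "g ** p = cscale c q" "c\<^sup>2 = -1"
proof -
  obtain g c' where pq: "p \<in> pauli_strings" "q \<in> pauli_strings" and g: "g \<in> \<G>"
    and c': "c' \<noteq> 0" "commutator g p = cscale c' q"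
    using assms by (auto simp: commutator_edges_def)
  have gP: "g \<in> pauli_strings" using g generators by auto
  have "cscale c' q \<noteq> 0"
    using c' pauli_nonzero[OF pq(2)] by (auto simp: vec_eq_iff)
  then have "g ** p \<noteq> p ** g"
    using c' by (auto simp: commutator_def)
  then have anti: "g ** p = - (p ** g)"
    using pauli_commute_or_anticommute[OF gP pq(1)] by blast
  then have "cscale 2 (g ** p) = cscale c' q"
    using c'(2) unfolding commutator_def anticommute_swap[OF anti] by (simp add: cscale_two)
  then have "cscale (1/2) (cscale 2 (g ** p)) = cscale (1/2) (cscale c' q)"
    by (rule arg_cong)
  then have gp: "g ** p = cscale (c' / 2) q"
    by simp
  \<comment> \<open>Squaring determines the phase: anticommutation gives -1 for the square of
    \<open>g ** p\<close>, whereas \<open>q\<close> squares to the identity.\<close>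
  have "(g ** p) ** (g ** p) = - ((p ** g) ** (g ** p))"
    by (subst anti) simp
  also have "\<dots> = - (p ** (g ** g) ** p)"
    by (simp add: matrix_mul_assoc)
  also have "\<dots> = - mat 1"
    by (simp add: pauli_square gP pq)
  finally have "cscale ((c' / 2)\<^sup>2) (mat 1) = - (mat 1 :: 'n operator)"
    unfolding gp by (simp add: pauli_square pq power2_eq_square)
  then have "(c' / 2)\<^sup>2 = -1"
    by (auto simp: vec_eq_iff mat_def split: if_splits)
  with that[OF g anti gp] show ?thesis .
qed

lemma edgeI:
  assumes "p \<in> pauli_strings" "q \<in> pauli_strings" "g \<in> \<G>" "g ** p = - (p ** g)"
    "g ** p = cscale c q" "c \<noteq> 0"
  shows "(p, q) \<in> commutator_edges \<G>"
proof -
  have "commutator g p = cscale 2 (g ** p)"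
    unfolding commutator_def anticommute_swap[OF assms(4)] by (simp add: cscale_two)
  also have "\<dots> = cscale (2 * c) q"
    using assms(5) by simp
  finally have "commutator g p = cscale (2 * c) q" .
  moreover have "2 * c \<noteq> 0" using assms(6) by simp
  ultimately show ?thesis
    unfolding commutator_edges_def using assms(1-3) by blast
qed

lemma edge_pauli:
  assumes "(p, q) \<in> commutator_edges \<G>"
  shows "p \<in> pauli_strings" "q \<in> pauli_strings"
  using assms by (auto simp: commutator_edges_def)

text \<open>As \<open>g\<close> squares to the identity, multiplying \<open>q\<close> by the same
  \<open>g\<close> leads back to \<open>p\<close> up to a scalar.\<close>

lemma edge_sym:
  assumes "(p, q) \<in> commutator_edges \<G>"
  shows "(q, p) \<in> commutator_edges \<G>"
proof -
  obtain g c where g: "g \<in> \<G>" "g ** p = - (p ** g)" "g ** p = cscale c q" "c\<^sup>2 = -1"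
    using assms by (rule edgeE)
  have gP: "g \<in> pauli_strings" using g generators by auto
  have c: "c \<noteq> 0" using g(4) by auto
  have q: "q = cscale (1 / c) (g ** p)"
    using c by (simp add: g(3))
  have "g ** q = cscale (1 / c) p"
    by (simp add: q matrix_mul_assoc pauli_square gP)
  moreover have "q ** g = - cscale (1 / c) p"
    unfolding q cscale_mult_left by (subst g(2)) (simp add: pauli_square gP cscale_minus flip: matrix_mul_assoc)
  ultimately show ?thesis
    using edgeI[of q p g "1 / c"] edge_pauli[OF assms] g(1) c by simp
qed

text \<open>Cyclicity of the trace moves the commutator from \<open>X\<close> to \<open>r\<close>.
  The commutator of \<open>r\<close> and \<open>g\<close> is zero or a multiple of a neighbour of
  \<open>r\<close>, which lies outside \<open>C\<close> together with \<open>r\<close>.\<close>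

lemma commutator_pauli_span:
  assumes "g \<in> \<G>" "edge_closed \<G> C" "X \<in> pauli_span C"
  shows "commutator g X \<in> pauli_span C"
  unfolding pauli_span_def
proof (intro CollectI ballI)
  fix r assume r: "r \<in> pauli_strings - C"
  have gP: "g \<in> pauli_strings" using assms generators by auto
  have "trace (r ** commutator g X) = trace (r ** g ** X) - trace ((r ** X) ** g)"
    by (simp add: commutator_def matrix_diff_ldistrib trace_diff matrix_mul_assoc)
  also have "trace ((r ** X) ** g) = trace (g ** r ** X)"
    by (subst trace_mul_sym) (simp add: matrix_mul_assoc)
  finally have *: "trace (r ** commutator g X) = trace (r ** g ** X) - trace (g ** r ** X)" .
  show "trace (r ** commutator g X) = 0"
  proof (cases "g ** r = r ** g")
    case True
    then show ?thesis using * by simp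
  next
    case False
    then have anti: "g ** r = - (r ** g)"
      using pauli_commute_or_anticommute[OF gP, of r] r by auto
    note anti' = anticommute_swap[OF anti]
    obtain c q where c: "cmod c = 1" "q \<in> pauli_strings" "g ** r = cscale c q"
      using pauli_mult[OF gP, of r] r by auto
    have "(r, q) \<in> commutator_edges \<G>"
      using r c anti assms(1) by (intro edgeI[of r q g c]) auto
    then have "q \<notin> C"
      using assms(2) r by (auto simp: edge_closed_def)
    then have "trace (q ** X) = 0"
      using assms(3) c by (simp add: pauli_span_def)
    then show ?thesis
      by (simp add: * anti' c)
  qed
qed

text \<open>The matrices with all three properties form a real Lie algebra containing the generators
  times \<i>, hence containing the hull. Closure under commutators comes from the Jacobi
  identity.\<close>

lemma dynamical_lie_algebra_properties:
  assumes "A \<in> dynamical_lie_algebra \<G>"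
  shows "dagger A = - A" "L \<in> pauli_symmetries \<G> \<Longrightarrow> commutator A L = 0"
    "edge_closed \<G> C \<Longrightarrow> X \<in> pauli_span C \<Longrightarrow> commutator A X \<in> pauli_span C"
proof -
  define \<L> where "\<L> = {A. dagger A = - A \<and> (\<forall>L\<in>pauli_symmetries \<G>. commutator A L = 0)
    \<and> (\<forall>C. edge_closed \<G> C \<longrightarrow> (\<forall>X\<in>pauli_span C. commutator A X \<in> pauli_span C))}"
  have "is_real_lie_algebra \<L>"
    unfolding is_real_lie_algebra_def
  proof (intro conjI ballI)
    have "0 \<in> pauli_span C" for C :: "'n operator set" by (simp add: pauli_span_def)
    then show "subspace \<L>"
      by (auto simp: subspace_def \<L>_def dagger_add commutator_add pauli_span_add scaleR_eq_cscale
          dagger_cscale commutator_cscale pauli_span_cscale cscale_minus)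
    fix A B assume "A \<in> \<L>" "B \<in> \<L>"
    then show "commutator A B \<in> \<L>"
      by (auto simp: \<L>_def dagger_commutator commutator_commutator pauli_span_diff)
        (simp add: commutator_def)
  qed
  moreover have "commutator g L = 0" if "g \<in> \<G>" "L \<in> pauli_symmetries \<G>" for g L
    using that by (simp add: pauli_symmetries_def commutator_def)
  then have "cscale \<i> ` \<G> \<subseteq> \<L>"
    using generators
    by (auto simp: \<L>_def dagger_cscale pauli_hermitian cscale_minus commutator_cscale
        commutator_pauli_span pauli_span_cscale subset_iff)
  ultimately have "dynamical_lie_algebra \<G> \<subseteq> \<L>"
    unfolding dynamical_lie_algebra_def by (intro hull_minimal)
  then have "A \<in> \<L>" using assms by blast
  then show "dagger A = - A" "L \<in> pauli_symmetries \<G> \<Longrightarrow> commutator A L = 0"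
    "edge_closed \<G> C \<Longrightarrow> X \<in> pauli_span C \<Longrightarrow> commutator A X \<in> pauli_span C"
    by (auto simp: \<L>_def)
qed

section \<open>Elements of the dynamical Lie group\<close>

lemma dynamical_lie_group_unitary:
  assumes "U \<in> dynamical_lie_group \<G>"
  shows "U ** dagger U = mat 1" "dagger U ** U = mat 1"
proof -
  obtain A where A: "A \<in> dynamical_lie_algebra \<G>" "U = matrix_exp A"
    using assms by (auto simp: dynamical_lie_group_def)
  then show "U ** dagger U = mat 1" "dagger U ** U = mat 1"
    using matrix_exp_inverse[of A] matrix_exp_inverse[of "- A"]
    by (simp_all add: dagger_matrix_exp dynamical_lie_algebra_properties(1))
qed

lemma dynamical_lie_group_symmetry:
  assumes "U \<in> dynamical_lie_group \<G>" "L \<in> pauli_symmetries \<G>"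
  shows "U ** L = L ** U"
proof -
  obtain A where A: "A \<in> dynamical_lie_algebra \<G>" "U = matrix_exp A"
    using assms by (auto simp: dynamical_lie_group_def)
  then have "U ** L ** dagger U = L"
    using assms(2) by (simp add: dagger_matrix_exp dynamical_lie_algebra_properties
        matrix_exp_conjugation_fixed)
  then have "U ** L ** (dagger U ** U) = L ** U"
    by (simp add: matrix_mul_assoc)
  then show ?thesis
    by (simp add: dynamical_lie_group_unitary assms)
qed

lemma dynamical_lie_group_pauli_span:
  assumes "U \<in> dynamical_lie_group \<G>" "edge_closed \<G> C" "X \<in> pauli_span C"
  shows "U ** X ** dagger U \<in> pauli_span C"
proof -
  obtain A where A: "A \<in> dynamical_lie_algebra \<G>" "U = matrix_exp A"
    using assms by (auto simp: dynamical_lie_group_def)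
  have "(commutator A ^^ m) X \<in> pauli_span C" for m
    by (induction m) (simp_all add: assms A dynamical_lie_algebra_properties(3))
  then show ?thesis
    using A by (simp add: pauli_span_def dagger_matrix_exp dynamical_lie_algebra_properties(1)
        trace_conjugation_zero)
qed

lemma exp_generator:
  assumes "g \<in> \<G>"
  shows "cscale (of_real (cos t)) (mat 1) + cscale (\<i> * of_real (sin t)) g \<in> dynamical_lie_group \<G>"
proof -
  have "t *\<^sub>R cscale \<i> g \<in> dynamical_lie_algebra \<G>"
    using assms unfolding dynamical_lie_algebra_def hull_def
    by (auto simp: is_real_lie_algebra_def intro: subspace_scale)
  moreover have "t *\<^sub>R cscale \<i> g = cscale (\<i> * of_real t) g"
    by (simp add: scaleR_eq_cscale mult.commute)
  moreover have "g ** g = mat 1"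
    using assms generators pauli_square by auto
  ultimately show ?thesis
    unfolding dynamical_lie_group_def by (metis imageI matrix_exp_involution)
qed

text \<open>Conjugation by this element is conjugation by \<open>g\<close>: it flips the sign of
  exactly those strings that anticommute with \<open>g\<close>.\<close>

lemma generator_in_group: "g \<in> \<G> \<Longrightarrow> cscale \<i> g \<in> dynamical_lie_group \<G>"
  using exp_generator[of g "pi / 2"] by simp

text \<open>Conjugation by this element carries a string anticommuting with \<open>g\<close> to its
  neighbour along \<open>g\<close>, up to sign.\<close>

lemma root_generator_in_group:
  "g \<in> \<G> \<Longrightarrow> cscale (of_real (sqrt 2 / 2)) (mat 1 + cscale \<i> g) \<in> dynamical_lie_group \<G>"
  using exp_generator[of g "pi / 4"] by (simp add: cos_45 sin_45 cscale_add_right mult.commute)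

section \<open>Components and isolated vertices\<close>

lemma same_component_eq: "same_component \<G> = (commutator_edges \<G>)\<^sup>*"
proof -
  have "(commutator_edges \<G>)\<inverse> = commutator_edges \<G>"
    using edge_sym by auto
  then show ?thesis by (simp add: same_component_def)
qed

lemma equiv_same_component: "equiv UNIV (same_component \<G>)"
  unfolding same_component_def
  by (intro equivI refl_rtrancl trans_rtrancl sym_rtrancl sym_Un_converse subset_UNIV) simp

lemma component_subset: "p \<in> pauli_strings \<Longrightarrow> same_component \<G> `` {p} \<subseteq> pauli_strings"
proof
  fix q assume "p \<in> pauli_strings" "q \<in> same_component \<G> `` {p}"
  then have "(p, q) \<in> (commutator_edges \<G>)\<^sup>*" by (simp add: same_component_eq)
  then show "q \<in> pauli_strings"
    using \<open>p \<in> pauli_strings\<close> by (induction rule: rtrancl_induct) (auto dest: edge_pauli)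
qed

lemma edge_closed_component: "edge_closed \<G> (same_component \<G> `` {p})"
  unfolding edge_closed_def same_component_eq
  by (auto dest: edge_sym intro: rtrancl_into_rtrancl)

lemma component_symmetry_iff:
  assumes "p \<in> pauli_strings"
  shows "card (same_component \<G> `` {p}) = 1 \<longleftrightarrow> p \<in> pauli_symmetries \<G>"
proof
  have p: "p \<in> same_component \<G> `` {p}"
    by (simp add: same_component_def)
  assume "card (same_component \<G> `` {p}) = 1"
  then have single: "same_component \<G> `` {p} = {p}"
    using p by (metis card_1_singletonE singletonD)
  show "p \<in> pauli_symmetries \<G>"
    unfolding pauli_symmetries_def
  proof (intro CollectI conjI ballI assms)
    fix g assume g: "g \<in> \<G>"
    then have gP: "g \<in> pauli_strings" using generators by auto
    obtain c q where c: "cmod c = 1" "q \<in> pauli_strings" "g ** p = cscale c q"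
      using pauli_mult[OF gP assms] .
    show "g ** p = p ** g"
    proof (rule ccontr)
      assume "g ** p \<noteq> p ** g"
      then have anti: "g ** p = - (p ** g)"
        using pauli_commute_or_anticommute[OF gP assms] by auto
      have "(p, q) \<in> commutator_edges \<G>"
        using c anti g assms by (intro edgeI[of p q g c]) auto
      then have "q = p"
        using single by (auto simp: same_component_eq)
      \<comment> \<open>If \<open>p\<close> were its own neighbour, cancelling \<open>p\<close>
        would make \<open>g\<close> a scalar matrix, which commutes with \<open>p\<close>.\<close>
      then have "g ** p ** p = cscale c (p ** p)"
        using c by simp
      then have "g = cscale c (mat 1)"
        by (simp add: pauli_square assms flip: matrix_mul_assoc)
      then show False
        using \<open>g ** p \<noteq> p ** g\<close> by simp
    qed
  qed
next
  assume sym: "p \<in> pauli_symmetries \<G>"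
  have "(p, q) \<notin> commutator_edges \<G>" for q
  proof
    assume e: "(p, q) \<in> commutator_edges \<G>"
    obtain g c where g: "g \<in> \<G>" "g ** p = - (p ** g)" "g ** p = cscale c q" "c\<^sup>2 = -1"
      using e by (rule edgeE)
    have "commutator g p = 0"
      using sym g(1) by (simp add: pauli_symmetries_def commutator_def)
    moreover have "commutator g p = cscale (2 * c) q"
      unfolding commutator_def anticommute_swap[OF g(2)] g(3) by (simp flip: cscale_add_left)
    moreover have "cscale (1 / (2 * c)) (cscale (2 * c) q) = q" using g(4) by auto
    ultimately have "q = 0" by (metis cscale_zero(2))
    then show False using pauli_nonzero edge_pauli[OF e] by auto
  qed
  then have "same_component \<G> `` {p} = {p}"
    by (auto simp: same_component_eq elim: converse_rtranclE)
  then show "card (same_component \<G> `` {p}) = 1" by simp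
qed

lemma card_isolated_vertices: "card (isolated_vertices \<G>) = card (pauli_symmetries \<G>)"
proof -
  have "bij_betw (\<lambda>L. {L}) (pauli_symmetries \<G>) (isolated_vertices \<G>)"
  proof (intro bij_betw_imageI set_eqI iffI)
    show "inj_on (\<lambda>L. {L}) (pauli_symmetries \<G>)" by (simp add: inj_on_def)
    have single: "same_component \<G> `` {p} = {p}" if "card (same_component \<G> `` {p}) = 1" for p
    proof -
      have "p \<in> same_component \<G> `` {p}" by (simp add: same_component_def)
      then show ?thesis using that by (metis card_1_singletonE singletonD)
    qed
    fix C
    {
      assume "C \<in> (\<lambda>L. {L}) ` pauli_symmetries \<G>"
      then obtain L where L: "L \<in> pauli_symmetries \<G>" "C = {L}" by auto
      then have P: "L \<in> pauli_strings" by (simp add: pauli_symmetries_def)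
      have "C = same_component \<G> `` {L}"
        using single[of L] component_symmetry_iff[OF P] L by simp
      then show "C \<in> isolated_vertices \<G>"
        unfolding isolated_vertices_def connected_components_def using P L by (auto simp: quotient_def)
    next
      assume "C \<in> isolated_vertices \<G>"
      then obtain p where "p \<in> pauli_strings" "C = same_component \<G> `` {p}" "card C = 1"
        by (auto simp: isolated_vertices_def connected_components_def quotient_def)
      then show "C \<in> (\<lambda>L. {L}) ` pauli_symmetries \<G>"
        using single[of p] component_symmetry_iff[of p] by auto
    }
  qed
  then show ?thesis by (simp add: bij_betw_same_card)
qed

text \<open>A component \<open>C\<close> contributes \<open>card C\<close> summands, each equal to
  \<open>1 / card C\<close>.\<close>

lemma sum_inverse_card_component:
  "(\<Sum>p\<in>pauli_strings. 1 / of_nat (card (same_component \<G> `` {p})) :: real)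
    = of_nat (card (connected_components \<G>))"
proof -
  let ?c = "\<lambda>p. same_component \<G> `` {p}"
  have img: "?c ` pauli_strings = connected_components \<G>"
    by (auto simp: connected_components_def quotient_def)
  have fibre: "{p \<in> pauli_strings. ?c p = ?c q} = ?c q" if q: "q \<in> pauli_strings" for q
  proof -
    have "?c p = ?c q \<longleftrightarrow> p \<in> ?c q" for p
      using eq_equiv_class_iff[OF equiv_same_component, of q p] by auto
    then show ?thesis using component_subset[OF q] by auto
  qed
  have "(\<Sum>p\<in>pauli_strings. 1 / of_nat (card (?c p)) :: real)
      = (\<Sum>C\<in>?c ` pauli_strings. \<Sum>p\<in>{p \<in> pauli_strings. ?c p = C}. 1 / of_nat (card (?c p)))"
    by (rule sum.image_gen) simp
  also have "\<dots> = (\<Sum>C\<in>?c ` pauli_strings. 1)"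
  proof (rule sum.cong[OF refl])
    fix C assume "C \<in> ?c ` pauli_strings"
    then obtain q where q: "q \<in> pauli_strings" "C = ?c q" by auto
    have "finite C" 
      unfolding q(2) by (rule finite_subset[OF component_subset[OF q(1)] finite_pauli_strings])
    moreover have "q \<in> C" using q by (simp add: same_component_def)
    ultimately have "card C \<noteq> 0" by auto
    have "(\<Sum>p\<in>{p \<in> pauli_strings. ?c p = C}. 1 / of_nat (card (?c p)) :: real)
        = (\<Sum>p\<in>{p \<in> pauli_strings. ?c p = C}. 1 / of_nat (card C))"
      by (intro sum.cong) auto
    also have "\<dots> = 1"
      unfolding q(2) fibre[OF q(1)] using \<open>card C \<noteq> 0\<close> q(2) by simp
    finally show "(\<Sum>p\<in>{p \<in> pauli_strings. ?c p = C}. 1 / of_nat (card (?c p)) :: real) = 1" .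
  qed
  finally show ?thesis by (simp add: img)
qed

end

section \<open>Matrix coefficients of the adjoint representation\<close>

text \<open>Parseval's identity, in bilinear form, for the orthogonal basis of Pauli
  strings.\<close>

lemma sum_pauli_trace_mult:
  fixes X Y :: "'n::finite operator"
  shows "(\<Sum>p\<in>pauli_strings. trace (p ** X) * trace (p ** Y)) = 2 ^ CARD('n) * trace (X ** Y)"
proof -
  have "(\<Sum>p\<in>pauli_strings. trace (p ** X) * trace (p ** Y))
      = (\<Sum>p\<in>pauli_strings. \<Sum>x\<in>UNIV. \<Sum>z\<in>UNIV. \<Sum>y\<in>UNIV. \<Sum>w\<in>UNIV.
          (p $ x $ y * p $ z $ w) * (X $ y $ x * Y $ w $ z))"
    unfolding trace_mult sum_product by (intro sum.cong refl) (simp add: ac_simps)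
  also have "\<dots> = (\<Sum>x\<in>UNIV. \<Sum>z\<in>UNIV. \<Sum>y\<in>UNIV. \<Sum>w\<in>UNIV.
          (\<Sum>p\<in>pauli_strings. p $ x $ y * p $ z $ w) * (X $ y $ x * Y $ w $ z))"
    unfolding sum_distrib_right
    by (subst sum.swap, intro sum.cong refl)+
  also have "\<dots> = (\<Sum>x\<in>UNIV. \<Sum>z\<in>UNIV. \<Sum>y\<in>UNIV. \<Sum>w\<in>UNIV.
          if w = x then if z = y then 2 ^ CARD('n) * (X $ y $ x * Y $ w $ z) else 0 else 0)"
    unfolding pauli_strings_complete by (intro sum.cong refl) auto
  also have "\<dots> = (\<Sum>x\<in>UNIV. \<Sum>y\<in>UNIV. \<Sum>z\<in>UNIV.
          if z = y then 2 ^ CARD('n) * (X $ y $ x * Y $ x $ z) else 0)"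
    by (subst (2) sum.swap) simp
  also have "\<dots> = 2 ^ CARD('n) * trace (X ** Y)"
    by (subst sum.swap) (simp add: trace_mult sum_distrib_left)
  finally show ?thesis .
qed

text \<open>The Pauli twirl: summing over all conjugations retains only the trace of
  \<open>X\<close>.\<close>

lemma sum_pauli_conjugation:
  fixes X :: "'n::finite operator"
  shows "(\<Sum>q\<in>pauli_strings. q ** X ** q) = cscale (2 ^ CARD('n) * trace X) (mat 1)"
proof -
  have "(\<Sum>q\<in>pauli_strings. q ** X ** q) $ x $ w
      = cscale (2 ^ CARD('n) * trace X) (mat 1) $ x $ w" for x w
  proof -
    have "(\<Sum>q\<in>pauli_strings. q ** X ** q) $ x $ w
        = (\<Sum>q\<in>pauli_strings. \<Sum>z\<in>UNIV. \<Sum>y\<in>UNIV. (q $ x $ y * q $ z $ w) * X $ y $ z)"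
      by (simp add: matrix_matrix_mult_def sum_distrib_right) (simp add: ac_simps)
    also have "\<dots> = (\<Sum>z\<in>UNIV. \<Sum>y\<in>UNIV. (\<Sum>q\<in>pauli_strings. q $ x $ y * q $ z $ w) * X $ y $ z)"
      unfolding sum_distrib_right
      by (subst sum.swap, intro sum.cong refl)+
    also have "\<dots> = (\<Sum>z\<in>UNIV. \<Sum>y\<in>UNIV. if y = z then if x = w then 2 ^ CARD('n) * X $ y $ z else 0 else 0)"
      unfolding pauli_strings_complete by (intro sum.cong refl) auto
    also have "\<dots> = cscale (2 ^ CARD('n) * trace X) (mat 1) $ x $ w"
      by (auto simp: trace_def mat_def sum_distrib_left)
    finally show ?thesis .
  qed
  then show ?thesis by (simp add: vec_eq_iff)
qed

text \<open>For Pauli strings this is an entry of the matrix of conjugation by \<open>U\<close>. The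
  row argument \<open>X\<close> is an arbitrary operator, since it will be conjugated by group
  elements and multiplied by symmetries.\<close>

definition adjoint_coeff :: "'n::finite operator \<Rightarrow> 'n operator \<Rightarrow> 'n operator \<Rightarrow> complex" where
  "adjoint_coeff X q U = trace (X ** (U ** q ** dagger U)) / 2 ^ CARD('n)"

lemma adjoint_coeff_cscale [simp]: "adjoint_coeff (cscale c X) q U = c * adjoint_coeff X q U"
  by (simp add: adjoint_coeff_def)

text \<open>By cyclicity of the trace, a left translation of \<open>U\<close> becomes a conjugation
  of the row argument; Haar invariance is exploited in this form.\<close>

lemma adjoint_coeff_mult: "adjoint_coeff X q (W ** U) = adjoint_coeff (dagger W ** X ** W) q U"
proof -
  have "trace (X ** (W ** U ** q ** dagger (W ** U))) = trace ((X ** W ** (U ** q ** dagger U)) ** dagger W)"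
    by (simp add: dagger_mult matrix_mul_assoc)
  also have "\<dots> = trace (dagger W ** X ** W ** (U ** q ** dagger U))"
    by (subst trace_mul_sym) (simp add: matrix_mul_assoc)
  finally show ?thesis by (simp add: adjoint_coeff_def)
qed

lemma cnj_adjoint_coeff:
  assumes "p \<in> pauli_strings" "q \<in> pauli_strings"
  shows "cnj (adjoint_coeff p q U) = adjoint_coeff p q U"
proof -
  have "cnj (trace (p ** (U ** q ** dagger U))) = trace (dagger (p ** (U ** q ** dagger U)))"
    by (simp add: trace_dagger)
  also have "\<dots> = trace ((U ** q ** dagger U) ** p)"
    by (simp add: dagger_mult pauli_hermitian assms matrix_mul_assoc)
  also have "\<dots> = trace (p ** (U ** q ** dagger U))"
    by (rule trace_mul_sym)
  finally show ?thesis by (simp add: adjoint_coeff_def)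
qed

text \<open>Parseval's identity carries out the sum over \<open>p\<close>, and the twirl then splits
  the sum over \<open>q\<close> into \<open>trace (dagger U ** V)\<close> times
  \<open>trace (U ** dagger V)\<close>, two conjugate numbers.\<close>

lemma sum_adjoint_coeff:
  fixes U V :: "'n::finite operator"
  shows "(\<Sum>p\<in>pauli_strings. \<Sum>q\<in>pauli_strings. adjoint_coeff p q U * cnj (adjoint_coeff p q V))
    = of_real ((cmod (trace (U ** dagger V)))\<^sup>2)"
proof -
  let ?D = "2 ^ CARD('n) :: complex"
  have "(\<Sum>p\<in>pauli_strings. \<Sum>q\<in>pauli_strings. adjoint_coeff p q U * cnj (adjoint_coeff p q V))
    = (\<Sum>q\<in>pauli_strings. \<Sum>p\<in>pauli_strings. adjoint_coeff p q U * adjoint_coeff p q V)"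
    by (subst sum.swap) (simp add: cnj_adjoint_coeff)
  also have "\<dots> = (\<Sum>q\<in>pauli_strings. (\<Sum>p\<in>pauli_strings. trace (p ** (U ** q ** dagger U)) * trace (p ** (V ** q ** dagger V))) / ?D\<^sup>2)"
    by (simp add: adjoint_coeff_def sum_divide_distrib power2_eq_square)
  also have "\<dots> = (\<Sum>q\<in>pauli_strings. trace (U ** (q ** (dagger U ** V) ** q) ** dagger V) / ?D)"
    unfolding sum_pauli_trace_mult by (simp add: power2_eq_square matrix_mul_assoc)
  also have "\<dots> = trace (U ** (\<Sum>q\<in>pauli_strings. q ** (dagger U ** V) ** q) ** dagger V) / ?D"
  proof -
    have "trace (sum f A) = (\<Sum>a\<in>A. trace (f a))" for f :: "'n operator \<Rightarrow> 'n operator" and A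
      by (induction A rule: infinite_finite_induct) (simp_all add: trace_add)
    then show ?thesis
      by (simp add: matrix_mult_sum_left matrix_mult_sum_right sum_divide_distrib)
  qed
  also have "\<dots> = trace (dagger U ** V) * trace (U ** dagger V)"
    by (simp add: sum_pauli_conjugation)
  also have "trace (dagger U ** V) = cnj (trace (U ** dagger V))"
    by (subst trace_mul_sym) (simp add: dagger_mult flip: trace_dagger)
  finally show ?thesis
    unfolding complex_norm_square by (simp only: mult.commute)
qed

text \<open>Up to a phase \<open>q ** L\<close> is a Pauli string, and by orthogonality only
  \<open>r\<close> equal to it contributes.\<close>

lemma sum_norm_trace_pauli:
  fixes q L :: "'n::finite operator"
  assumes "q \<in> pauli_strings" "L \<in> pauli_strings"
  shows "(\<Sum>r\<in>pauli_strings. (cmod (trace (q ** L ** r) / 2 ^ CARD('n)))\<^sup>2) = 1"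
proof -
  obtain c s where cs: "cmod c = 1" "s \<in> pauli_strings" "q ** L = cscale c s"
    using pauli_mult[OF assms] .
  have "(\<Sum>r\<in>pauli_strings. (cmod (trace (q ** L ** r) / 2 ^ CARD('n)))\<^sup>2)
      = (\<Sum>r\<in>pauli_strings. if s = r then 1 else 0)"
    by (intro sum.cong refl) (simp add: cs trace_pauli_mult norm_mult norm_divide norm_power)
  then show ?thesis by (simp add: cs)
qed

text \<open>Multiplication by \<open>p\<close> permutes the Pauli strings up to phases, to which
  \<open>f\<close> is insensitive.\<close>

lemma sum_pauli_reindex:
  fixes p :: "'n::finite operator" and f :: "'n operator \<Rightarrow> real"
  assumes p: "p \<in> pauli_strings" and f: "\<And>c r. cmod c = 1 \<Longrightarrow> f (cscale c r) = f r"
  shows "(\<Sum>r\<in>pauli_strings. f r) = (\<Sum>L\<in>pauli_strings. f (p ** L))"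
proof -
  have "\<forall>L\<in>pauli_strings. \<exists>c r. cmod c = 1 \<and> r \<in> pauli_strings \<and> p ** L = cscale c r"
    using pauli_mult[OF p] by metis
  then obtain c \<phi> where \<phi>: "\<And>L. L \<in> pauli_strings \<Longrightarrow> cmod (c L) = 1 \<and> \<phi> L \<in> pauli_strings
      \<and> p ** L = cscale (c L) (\<phi> L)"
    by metis
  have L: "L = cscale (c L) (p ** \<phi> L)" if "L \<in> pauli_strings" for L
  proof -
    have "L = p ** (p ** L)" by (simp add: matrix_mul_assoc pauli_square p)
    then show ?thesis using \<phi>[OF that] by simp
  qed
  \<comment> \<open>Equal images make \<open>L\<close> a nonzero multiple of \<open>M\<close>, and
    distinct strings are orthogonal.\<close>
  have "inj_on \<phi> pauli_strings"
  proof (rule inj_onI)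
    fix L M :: "'n operator" assume LM: "L \<in> pauli_strings" "M \<in> pauli_strings" "\<phi> L = \<phi> M"
    have "c M \<noteq> 0" using \<phi>[OF LM(2)] by auto
    then have "L = cscale (c L / c M) M"
      by (subst L[OF LM(1)], subst (2) L[OF LM(2)]) (simp add: LM(3))
    then have "trace (L ** M) = c L / c M * trace (M ** M)"
      by (metis cscale_mult_left trace_cscale)
    moreover have "c L / c M \<noteq> 0" using \<phi>[OF LM(1)] \<phi>[OF LM(2)] by auto
    ultimately show "L = M"
      using LM by (auto simp: trace_pauli_mult split: if_splits)
  qed
  moreover have "\<phi> ` pauli_strings \<subseteq> pauli_strings"
    using \<phi> by auto
  ultimately have "bij_betw \<phi> pauli_strings pauli_strings"
    by (simp add: bij_betw_def endo_inj_surj)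
  then have "(\<Sum>r\<in>pauli_strings. f r) = (\<Sum>L\<in>pauli_strings. f (\<phi> L))"
    by (rule sum.reindex_bij_betw[symmetric])
  also have "\<dots> = (\<Sum>L\<in>pauli_strings. f (p ** L))"
    by (intro sum.cong refl) (simp add: \<phi> f)
  finally show ?thesis .
qed

text \<open>For \<open>q\<close> in \<open>C\<close> the conjugate of \<open>q\<close> stays in the
  span of \<open>C\<close>. The sum thus extends to all strings, Parseval's identity evaluates it,
  and \<open>U\<close> cancels. For other \<open>q\<close> the conjugate is orthogonal to
  \<open>C\<close>.\<close>

lemma sum_component_adjoint_coeff:
  fixes \<G> :: "'n::finite operator set"
  assumes gen: "\<G> \<subseteq> pauli_strings" and U: "U \<in> dynamical_lie_group \<G>"
    and p: "p \<in> pauli_strings" and L: "L \<in> pauli_symmetries \<G>" and q: "q \<in> pauli_strings"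
  defines "C \<equiv> same_component \<G> `` {p}"
  shows "(\<Sum>r\<in>C. adjoint_coeff r q U * adjoint_coeff (r ** L) q' U)
    = (if q \<in> C then trace (q ** L ** q') / 2 ^ CARD('n) else 0)"
proof -
  have closed: "edge_closed \<G> C"
    unfolding C_def by (rule edge_closed_component[OF gen])
  have CP: "C \<subseteq> pauli_strings"
    unfolding C_def by (rule component_subset[OF gen p])
  show ?thesis
  proof (cases "q \<in> C")
    case True
    let ?Y = "U ** q ** dagger U" and ?Z = "U ** L ** q' ** dagger U"
    have "?Y \<in> pauli_span C"
      using dynamical_lie_group_pauli_span[OF gen U closed] pauli_span_base[OF True q] by blast
    then have "trace (r ** ?Y) = 0" if "r \<in> pauli_strings - C" for r
      using that by (simp add: pauli_span_def)
    then have "(\<Sum>r\<in>C. adjoint_coeff r q U * adjoint_coeff (r ** L) q' U)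
        = (\<Sum>r\<in>pauli_strings. adjoint_coeff r q U * adjoint_coeff (r ** L) q' U)"
      by (intro sum.mono_neutral_left CP) (auto simp: adjoint_coeff_def)
    also have "\<dots> = (\<Sum>r\<in>pauli_strings. trace (r ** ?Y) * trace (r ** ?Z)) / (2 ^ CARD('n))\<^sup>2"
    proof -
      \<comment> \<open>Commuting \<open>L\<close> past \<open>U\<close> turns the second
        coefficient into a trace against \<open>r\<close> alone, as Parseval's identity
        requires.\<close>
      have "r ** L ** (U ** q' ** dagger U) = r ** ?Z" for r :: "'n operator"
      proof -
        have "r ** L ** (U ** q' ** dagger U) = r ** (L ** U) ** q' ** dagger U"
          by (simp add: matrix_mul_assoc)
        also have "\<dots> = r ** ?Z"
          unfolding dynamical_lie_group_symmetry[OF gen U L, symmetric] by (simp add: matrix_mul_assoc)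
        finally show ?thesis .
      qed
      then show ?thesis
        by (simp only: adjoint_coeff_def times_divide_times_eq sum_divide_distrib power2_eq_square)
    qed
    also have "\<dots> = trace (?Y ** ?Z) / 2 ^ CARD('n)"
      unfolding sum_pauli_trace_mult by (simp add: power2_eq_square)
    also have "?Y ** ?Z = U ** q ** (dagger U ** U) ** L ** q' ** dagger U"
      by (simp add: matrix_mul_assoc)
    also have "trace \<dots> = trace (dagger U ** (U ** q ** L ** q'))"
      by (subst trace_mul_sym) (simp add: dynamical_lie_group_unitary[OF gen U])
    also have "dagger U ** (U ** q ** L ** q') = (dagger U ** U) ** (q ** L ** q')"
      by (simp add: matrix_mul_assoc)
    finally show ?thesis
      using True by (simp add: dynamical_lie_group_unitary[OF gen U])
  next
    case False
    \<comment> \<open>Symmetry of the edges lets the closure of \<open>C\<close> pass to its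
      complement, whose span contains \<open>q\<close>.\<close>
    have "edge_closed \<G> (- C)"
      using closed edge_sym[OF gen] unfolding edge_closed_def by blast
    then have "U ** q ** dagger U \<in> pauli_span (- C)"
      using dynamical_lie_group_pauli_span[OF gen U] pauli_span_base[of q "- C"] False q by blast
    then have "adjoint_coeff r q U = 0" if "r \<in> C" for r
      using that CP by (auto simp: pauli_span_def adjoint_coeff_def)
    then show ?thesis
      using False by simp
  qed
qed

section \<open>Haar averages\<close>

lemma continuous_adjoint_coeff: "continuous_on UNIV (adjoint_coeff X q)"
  unfolding adjoint_coeff_def trace_def matrix_matrix_mult_def dagger_def
  by (simp, intro continuous_intros) simp

text \<open>A crude bound; it only has to place the group inside some ball.\<close>

lemma unitary_norm_le:
  fixes U :: "complex^'m::finite^'m"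
  assumes "U ** dagger U = mat 1"
  shows "norm U \<le> real CARD('m) * real CARD('m)"
proof -
  have entry: "cmod (U $ i $ j) \<le> 1" for i j
  proof -
    have "(\<Sum>j\<in>UNIV. U $ i $ j * cnj (U $ i $ j)) = 1"
      using assms by (simp add: vec_eq_iff matrix_matrix_mult_def mat_def)
    then have "of_real (\<Sum>j\<in>UNIV. (cmod (U $ i $ j))\<^sup>2) = (1 :: complex)"
      by (simp only: of_real_sum complex_norm_square)
    then have "(\<Sum>j\<in>UNIV. (cmod (U $ i $ j))\<^sup>2) = 1"
      by (simp only: of_real_eq_1_iff)
    moreover have "(cmod (U $ i $ j))\<^sup>2 \<le> (\<Sum>j\<in>UNIV. (cmod (U $ i $ j))\<^sup>2)"
      by (rule member_le_sum) auto
    ultimately show ?thesis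
      by (simp add: abs_square_le_1)
  qed
  have "norm U \<le> (\<Sum>i\<in>UNIV. norm (U $ i))"
    unfolding norm_vec_def[of U] by (rule L2_set_le_sum) simp
  also have "\<dots> \<le> (\<Sum>i\<in>(UNIV :: 'm set). \<Sum>j\<in>(UNIV :: 'm set). 1)"
  proof (rule sum_mono)
    fix i
    have "norm (U $ i) \<le> (\<Sum>j\<in>UNIV. cmod (U $ i $ j))"
      unfolding norm_vec_def[of "U $ i"] by (rule L2_set_le_sum) simp
    also have "\<dots> \<le> (\<Sum>j\<in>(UNIV :: 'm set). 1)"
      by (intro sum_mono entry)
    finally show "norm (U $ i) \<le> (\<Sum>j\<in>(UNIV :: 'm set). 1)" .
  qed
  finally show ?thesis by simp
qed

text \<open>By Fubini, each summand integrates to the mean of \<open>f i\<close> times its own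
  conjugate.\<close>

lemma (in prob_space) integral_pair_sum_cnj:
  fixes f :: "'i \<Rightarrow> 'a \<Rightarrow> complex"
  assumes "finite I" and int: "\<And>i. i \<in> I \<Longrightarrow> integrable M (f i)"
  shows "integral\<^sup>L (M \<Otimes>\<^sub>M M) (\<lambda>(x, y). \<Sum>i\<in>I. f i x * cnj (f i y))
    = (\<Sum>i\<in>I. of_real ((cmod (integral\<^sup>L M (f i)))\<^sup>2))"
proof -
  interpret pair_prob_space M M ..
  have ip: "integrable (M \<Otimes>\<^sub>M M) (\<lambda>z. f i (fst z) * cnj (f i (snd z)))" if "i \<in> I" for i
  proof (rule Fubini_integrable)
    have "integrable M (\<lambda>y. cnj (f i y))"
      using int[OF that] by simp
    note [measurable] = borel_measurable_integrable[OF int[OF that]] borel_measurable_integrable[OF this]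
    show "(\<lambda>z. f i (fst z) * cnj (f i (snd z))) \<in> borel_measurable (M \<Otimes>\<^sub>M M)"
      by measurable
    show "integrable M (\<lambda>x. \<integral>y. norm (f i (fst (x, y)) * cnj (f i (snd (x, y)))) \<partial>M)"
      using int[OF that] by (simp add: norm_mult)
    show "AE x in M. integrable M (\<lambda>y. f i (fst (x, y)) * cnj (f i (snd (x, y))))"
      using int[OF that] by simp
  qed
  have "integral\<^sup>L (M \<Otimes>\<^sub>M M) (\<lambda>(x, y). \<Sum>i\<in>I. f i x * cnj (f i y))
      = (\<Sum>i\<in>I. integral\<^sup>L (M \<Otimes>\<^sub>M M) (\<lambda>z. f i (fst z) * cnj (f i (snd z))))"
    using ip by (simp add: case_prod_unfold)
  also have "\<dots> = (\<Sum>i\<in>I. of_real ((cmod (integral\<^sup>L M (f i)))\<^sup>2))"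
  proof (rule sum.cong[OF refl])
    fix i assume "i \<in> I"
    have "integral\<^sup>L (M \<Otimes>\<^sub>M M) (\<lambda>z. f i (fst z) * cnj (f i (snd z)))
        = (\<integral>x. (\<integral>y. f i x * cnj (f i y) \<partial>M) \<partial>M)"
      using integral_fst'[OF ip[OF \<open>i \<in> I\<close>]] by simp
    also have "\<dots> = integral\<^sup>L M (f i) * cnj (integral\<^sup>L M (f i))"
      by simp
    finally show "integral\<^sup>L (M \<Otimes>\<^sub>M M) (\<lambda>z. f i (fst z) * cnj (f i (snd z)))
        = of_real ((cmod (integral\<^sup>L M (f i)))\<^sup>2)"
      unfolding complex_norm_square by simp
  qed
  finally show ?thesis .
qed

section \<open>Second moments of the matrix coefficients\<close>

context
  fixes \<G> :: "'n::finite operator set" and \<mu> :: "'n operator measure"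
  assumes gen: "\<G> \<subseteq> pauli_strings"
    and haar: "haar_probability (dynamical_lie_group \<G>) \<mu>"
begin

interpretation prob_space \<mu>
  using haar by (simp add: haar_probability_def)

lemma haar_measurable: "continuous_on UNIV f \<Longrightarrow> f \<in> borel_measurable \<mu>"
  using haar borel_measurable_continuous_onI measurable_cong_sets[of \<mu> borel borel borel]
  by (auto simp: haar_probability_def)

text \<open>Almost every \<open>U\<close> is unitary and so lies in a compact ball, on which
  \<open>f\<close> is bounded.\<close>

lemma integrable_haar:
  fixes f :: "'n operator \<Rightarrow> complex"
  assumes "continuous_on UNIV f"
  shows "integrable \<mu> f"
proof -
  define R where "R = real CARD('n \<Rightarrow> 2) * real CARD('n \<Rightarrow> 2)"
  have "compact (f ` cball 0 R)"
    by (intro compact_continuous_image compact_cball continuous_on_subset[OF assms]) auto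
  then obtain B where B: "\<And>U. U \<in> cball 0 R \<Longrightarrow> cmod (f U) \<le> B"
    using compact_imp_bounded bounded_iff by (metis image_eqI)
  have "AE U in \<mu>. U \<in> dynamical_lie_group \<G>"
    using haar by (simp add: haar_probability_def)
  then have "AE U in \<mu>. cmod (f U) \<le> B"
  proof (eventually_elim)
    case (elim U)
    then show ?case
      using B[of U] unitary_norm_le[OF dynamical_lie_group_unitary(1)[OF gen elim]]
      by (simp add: R_def)
  qed
  then show ?thesis
    by (intro integrable_const_bound haar_measurable assms)
qed

lemma continuous_adjoint_coeff_mult:
  "continuous_on UNIV (\<lambda>U :: 'n operator. adjoint_coeff X q U * adjoint_coeff X' q' U)"
  by (intro continuous_on_mult continuous_adjoint_coeff)

text \<open>This is the average called \<open>K\<close> in the overview, with arbitrary operators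
  allowed as row arguments.\<close>

definition haar_coeff :: "'n operator \<Rightarrow> 'n operator \<Rightarrow> 'n operator \<Rightarrow> 'n operator \<Rightarrow> complex" where
  "haar_coeff X X' q q' = (\<integral>U. adjoint_coeff X q U * adjoint_coeff X' q' U \<partial>\<mu>)"

lemma haar_coeff_cscale: "haar_coeff (cscale a X) (cscale b X') q q' = a * b * haar_coeff X X' q q'"
proof -
  have "haar_coeff (cscale a X) (cscale b X') q q'
      = (\<integral>U. (a * b) * (adjoint_coeff X q U * adjoint_coeff X' q' U) \<partial>\<mu>)"
    by (simp add: haar_coeff_def ac_simps)
  then show ?thesis by (simp add: haar_coeff_def)
qed

lemma haar_coeff_invariant:
  assumes "W \<in> dynamical_lie_group \<G>"
  shows "haar_coeff (dagger W ** X ** W) (dagger W ** X' ** W) q q' = haar_coeff X X' q q'"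
proof -
  have "continuous_on UNIV (\<lambda>U :: 'n operator. W ** U)"
    unfolding matrix_matrix_mult_def by (intro continuous_intros)
  then have meas: "(\<lambda>U. W ** U) \<in> measurable \<mu> borel"
    by (rule haar_measurable)
  have "distr \<mu> borel (\<lambda>U. W ** U) = \<mu>"
    using haar assms by (simp add: haar_probability_def)
  then have "haar_coeff X X' q q' = (\<integral>U. adjoint_coeff X q U * adjoint_coeff X' q' U \<partial>distr \<mu> borel (\<lambda>U. W ** U))"
    by (simp add: haar_coeff_def)
  also have "\<dots> = (\<integral>U. adjoint_coeff X q (W ** U) * adjoint_coeff X' q' (W ** U) \<partial>\<mu>)"
    by (intro integral_distr meas borel_measurable_continuous_onI continuous_adjoint_coeff_mult)
  finally show ?thesis
    by (simp add: haar_coeff_def adjoint_coeff_mult)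
qed

text \<open>Conjugation by a generator \<open>g\<close> anticommuting with \<open>L\<close>
  multiplies \<open>p\<close> by a sign \<open>s\<close> and \<open>p ** L\<close> by
  \<open>- s\<close>, so invariance equates the average with its negative.\<close>

lemma haar_coeff_non_symmetry:
  assumes p: "p \<in> pauli_strings" and L: "L \<in> pauli_strings" "L \<notin> pauli_symmetries \<G>"
  shows "haar_coeff p (p ** L) q q' = 0"
proof -
  obtain g where g: "g \<in> \<G>" "g ** L \<noteq> L ** g"
    using L by (auto simp: pauli_symmetries_def)
  have gP: "g \<in> pauli_strings" using g gen by auto
  have gL: "g ** L = - (L ** g)"
    using pauli_commute_or_anticommute[OF gP L(1)] g(2) by auto
  obtain s where s: "s = 1 \<or> s = -1" "g ** p = cscale s (p ** g)"
    using pauli_commute_or_anticommute[OF gP p] by (metis cscale_minus(1) cscale_one)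
  let ?W = "cscale \<i> g"
  have conj: "dagger ?W ** X ** ?W = g ** X ** g" for X
    by (simp add: dagger_cscale pauli_hermitian[OF gP])
  have 1: "g ** p ** g = cscale s p"
    by (simp add: s(2) pauli_square[OF gP] flip: matrix_mul_assoc)
  have "g ** (p ** L) ** g = cscale s (p ** (g ** L) ** g)"
    by (simp add: s(2) matrix_mul_assoc)
  also have "\<dots> = cscale (- s) (p ** L ** (g ** g))"
    unfolding gL by (simp add: cscale_minus matrix_mul_assoc)
  finally have 2: "g ** (p ** L) ** g = cscale (- s) (p ** L)"
    by (simp add: pauli_square[OF gP])
  have "haar_coeff p (p ** L) q q' = haar_coeff (cscale s p) (cscale (- s) (p ** L)) q q'"
    using haar_coeff_invariant[OF generator_in_group[OF gen g(1)], of p "p ** L" q q']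
    unfolding conj 1 2 by simp
  also have "\<dots> = - haar_coeff p (p ** L) q q'"
    using s(1) unfolding haar_coeff_cscale by auto
  finally show ?thesis by simp
qed

text \<open>Conjugation by \<open>W\<close> sends \<open>p\<close> to a multiple of \<open>r\<close>
  and, because \<open>L\<close> commutes with \<open>W\<close>, sends \<open>p ** L\<close> to the
  same multiple of \<open>r ** L\<close>. The square of the common factor is 1.\<close>

lemma haar_coeff_edge:
  assumes e: "(p, r) \<in> commutator_edges \<G>" and L: "L \<in> pauli_symmetries \<G>"
  shows "haar_coeff r (r ** L) q q' = haar_coeff p (p ** L) q q'"
proof -
  obtain g c where g: "g \<in> \<G>" "g ** p = - (p ** g)" "g ** p = cscale c r" "c\<^sup>2 = -1"
    using edgeE[OF gen e] .
  have gP: "g \<in> pauli_strings" using g gen by auto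
  define a where "a = complex_of_real (sqrt 2 / 2)"
  define W where "W = cscale a (mat 1 + cscale \<i> g)"
  have W: "W \<in> dynamical_lie_group \<G>"
    unfolding W_def a_def by (rule root_generator_in_group[OF gen g(1)])
  have "a * a = 1 / 2"
    unfolding a_def of_real_mult[symmetric] by simp
  have dW: "dagger W = cscale a (mat 1 - cscale \<i> g)"
    by (simp add: W_def a_def dagger_cscale dagger_add pauli_hermitian[OF gP] cscale_minus)
  note pg = anticommute_swap[OF g(2)]
  have "g ** p ** g = - (g ** g ** p)"
    by (simp add: pg flip: matrix_mul_assoc)
  then have gpg: "g ** p ** g = - p"
    by (simp add: pauli_square[OF gP])
  have "dagger W ** p ** W = cscale (1 / 2) ((mat 1 - cscale \<i> g) ** p ** (mat 1 + cscale \<i> g))"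
    unfolding dW by (simp add: W_def \<open>a * a = 1 / 2\<close>)
  \<comment> \<open>The outer terms cancel because \<open>g ** p ** g = - p\<close>; the two mixed
    terms agree by anticommutation.\<close>
  also have "(mat 1 - cscale \<i> g) ** p ** (mat 1 + cscale \<i> g)
      = p - cscale \<i> (g ** p) + cscale \<i> (p ** g) + g ** p ** g"
    by (simp add: matrix_add_ldistrib matrix_diff_rdistrib cscale_minus cscale_diff_right)
  also have "\<dots> = cscale (- 2 * \<i>) (g ** p)"
    unfolding gpg pg by (simp add: vec_eq_iff)
  finally have conj: "dagger W ** p ** W = cscale (- \<i> * c) r"
    by (simp add: g(3))
  have "dagger W ** (p ** L) ** W = dagger W ** p ** (L ** W)"
    by (simp add: matrix_mul_assoc)
  also have "\<dots> = (dagger W ** p ** W) ** L"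
    unfolding dynamical_lie_group_symmetry[OF gen W L, symmetric] by (simp add: matrix_mul_assoc)
  finally have conjL: "dagger W ** (p ** L) ** W = cscale (- \<i> * c) (r ** L)"
    by (simp add: conj)
  have "(- \<i> * c) * (- \<i> * c) = 1"
    using g(4) by (simp add: power2_eq_square algebra_simps)
  then show ?thesis
    using haar_coeff_invariant[OF W, of p "p ** L" q q']
    unfolding conj conjL haar_coeff_cscale by simp
qed

lemma haar_coeff_component:
  assumes r: "r \<in> same_component \<G> `` {p}" and L: "L \<in> pauli_symmetries \<G>"
  shows "haar_coeff r (r ** L) q q' = haar_coeff p (p ** L) q q'"
proof -
  have "(p, r) \<in> (commutator_edges \<G>)\<^sup>*"
    using r by (simp add: same_component_eq[OF gen])
  then show ?thesis
    by (induction rule: rtrancl_induct) (simp_all add: haar_coeff_edge[OF _ L])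
qed

text \<open>All \<open>r\<close> in \<open>C\<close> have the same average, so the left side is the
  average of a sum over \<open>C\<close>. That sum is almost surely constant by
  \<open>sum_component_adjoint_coeff\<close>.\<close>

lemma haar_coeff_symmetry:
  fixes p :: "'n operator"
  assumes p: "p \<in> pauli_strings" and L: "L \<in> pauli_symmetries \<G>" and q: "q \<in> pauli_strings"
  defines "C \<equiv> same_component \<G> `` {p}"
  shows "of_nat (card C) * haar_coeff p (p ** L) q q'
    = (if q \<in> C then trace (q ** L ** q') / 2 ^ CARD('n) else 0)" (is "_ = ?c")
proof -
  have "AE U in \<mu>. U \<in> dynamical_lie_group \<G>"
    using haar by (simp add: haar_probability_def)
  then have ae: "AE U in \<mu>. (\<Sum>r\<in>C. adjoint_coeff r q U * adjoint_coeff (r ** L) q' U) = ?c"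
    by eventually_elim (use sum_component_adjoint_coeff[OF gen _ p L q] in \<open>simp add: C_def\<close>)
  have "of_nat (card C) * haar_coeff p (p ** L) q q' = (\<Sum>r\<in>C. haar_coeff p (p ** L) q q')"
    by simp
  also have "\<dots> = (\<Sum>r\<in>C. haar_coeff r (r ** L) q q')"
    by (intro sum.cong refl) (simp add: C_def haar_coeff_component[OF _ L])
  also have "\<dots> = (\<integral>U. (\<Sum>r\<in>C. adjoint_coeff r q U * adjoint_coeff (r ** L) q' U) \<partial>\<mu>)"
    unfolding haar_coeff_def
    by (intro Bochner_Integration.integral_sum[symmetric] integrable_haar continuous_adjoint_coeff_mult)
  also have "\<dots> = (\<integral>U. ?c \<partial>\<mu>)"
    using ae by (intro integral_cong_AE haar_measurable continuous_on_sum continuous_adjoint_coeff_mult) auto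
  also have "\<dots> = ?c"
    by (simp add: prob_space)
  finally show ?thesis .
qed

text \<open>The fourth power is the square of the sum in \<open>sum_adjoint_coeff\<close>. Expanding
  it gives a function of \<open>U\<close> times its conjugate at \<open>V\<close> for every
  quadruple of strings, and the two averages separate.\<close>

lemma frame_potential_eq_sum:
  "frame_potential 2 \<mu> = (\<Sum>p\<in>pauli_strings. \<Sum>q\<in>pauli_strings. \<Sum>p'\<in>pauli_strings. \<Sum>q'\<in>pauli_strings.
      (cmod (haar_coeff p p' q q'))\<^sup>2)"
proof -
  let ?P = "pauli_strings :: 'n operator set"
  define f where "f = (\<lambda>((p, q), (p', q')) (U :: 'n operator). adjoint_coeff p q U * adjoint_coeff p' q' U)"
  define I where "I = (?P \<times> ?P) \<times> (?P \<times> ?P)"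
  have "complex_of_real (cmod (trace (U ** dagger V)) ^ (2 * 2)) = (\<Sum>i\<in>I. f i U * cnj (f i V))" for U V
  proof -
    have "complex_of_real (cmod (trace (U ** dagger V)) ^ (2 * 2))
        = of_real ((cmod (trace (U ** dagger V)))\<^sup>2) * of_real ((cmod (trace (U ** dagger V)))\<^sup>2)"
      unfolding of_real_mult[symmetric] by (simp add: power2_eq_square power4_eq_xxxx mult.assoc)
    also have "\<dots> = (\<Sum>(p, q)\<in>?P \<times> ?P. adjoint_coeff p q U * cnj (adjoint_coeff p q V))
        * (\<Sum>(p, q)\<in>?P \<times> ?P. adjoint_coeff p q U * cnj (adjoint_coeff p q V))"
      by (simp only: sum_adjoint_coeff[symmetric] sum.cartesian_product)
    also have "\<dots> = (\<Sum>i\<in>I. f i U * cnj (f i V))"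
      unfolding sum_product sum.cartesian_product I_def f_def
      by (intro sum.cong refl) (auto simp: ac_simps)
    finally show ?thesis .
  qed
  then have "complex_of_real (frame_potential 2 \<mu>)
      = integral\<^sup>L (\<mu> \<Otimes>\<^sub>M \<mu>) (\<lambda>(U, V). \<Sum>i\<in>I. f i U * cnj (f i V))"
    unfolding frame_potential_def integral_complex_of_real[symmetric] by (simp add: case_prod_unfold)
  also have "\<dots> = (\<Sum>i\<in>I. of_real ((cmod (integral\<^sup>L \<mu> (f i)))\<^sup>2))"
    by (intro integral_pair_sum_cnj)
      (auto simp: I_def f_def intro!: integrable_haar continuous_adjoint_coeff_mult)
  also have "\<dots> = of_real (\<Sum>i\<in>I. (cmod (integral\<^sup>L \<mu> (f i)))\<^sup>2)"
    by simp
  finally have "frame_potential 2 \<mu> = (\<Sum>i\<in>I. (cmod (integral\<^sup>L \<mu> (f i)))\<^sup>2)"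
    by (simp only: of_real_eq_iff)
  also have "\<dots> = (\<Sum>p\<in>?P. \<Sum>q\<in>?P. \<Sum>p'\<in>?P. \<Sum>q'\<in>?P. (cmod (haar_coeff p p' q q'))\<^sup>2)"
    by (simp add: I_def f_def haar_coeff_def sum.cartesian_product')
  finally show ?thesis .
qed

text \<open>After the substitution of \<open>p ** L\<close> for \<open>p'\<close> only symmetries
  \<open>L\<close> survive. For each of them every \<open>q\<close> in \<open>C\<close> contributes
  the inverse square of \<open>card C\<close>, and there are \<open>card C\<close> such
  \<open>q\<close>.\<close>

lemma sum_haar_coeff_fibre:
  fixes p :: "'n operator"
  assumes p: "p \<in> pauli_strings"
  shows "(\<Sum>q\<in>pauli_strings. \<Sum>p'\<in>pauli_strings. \<Sum>q'\<in>pauli_strings. (cmod (haar_coeff p p' q q'))\<^sup>2)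
    = real (card (pauli_symmetries \<G>)) / real (card (same_component \<G> `` {p}))"
proof -
  let ?P = "pauli_strings :: 'n operator set"
  define C where "C = same_component \<G> `` {p}"
  have CP: "C \<subseteq> ?P"
    unfolding C_def by (rule component_subset[OF gen p])
  have symP: "pauli_symmetries \<G> \<subseteq> ?P"
    by (auto simp: pauli_symmetries_def)
  have "p \<in> C" by (simp add: C_def same_component_def)
  then have card: "card C \<noteq> 0"
    using finite_subset[OF CP] by auto
  have "(\<Sum>q\<in>?P. \<Sum>p'\<in>?P. \<Sum>q'\<in>?P. (cmod (haar_coeff p p' q q'))\<^sup>2)
      = (\<Sum>q\<in>?P. \<Sum>L\<in>?P. \<Sum>q'\<in>?P. (cmod (haar_coeff p (p ** L) q q'))\<^sup>2)"
  proof (rule sum.cong[OF refl], rule sum_pauli_reindex[OF p])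
    fix c :: complex and r q :: "'n operator"
    assume "cmod c = 1"
    then show "(\<Sum>q'\<in>?P. (cmod (haar_coeff p (cscale c r) q q'))\<^sup>2) = (\<Sum>q'\<in>?P. (cmod (haar_coeff p r q q'))\<^sup>2)"
      using haar_coeff_cscale[of 1 p c r] by (simp add: norm_mult)
  qed
  also have "\<dots> = (\<Sum>q\<in>?P. \<Sum>L\<in>pauli_symmetries \<G>. if q \<in> C then 1 / (real (card C))\<^sup>2 else 0)"
  proof (rule sum.cong[OF refl])
    fix q assume q: "q \<in> ?P"
    have "(\<Sum>L\<in>?P. \<Sum>q'\<in>?P. (cmod (haar_coeff p (p ** L) q q'))\<^sup>2)
        = (\<Sum>L\<in>pauli_symmetries \<G>. \<Sum>q'\<in>?P. (cmod (haar_coeff p (p ** L) q q'))\<^sup>2)"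
      using symP by (intro sum.mono_neutral_right) (auto simp: haar_coeff_non_symmetry[OF p])
    also have "\<dots> = (\<Sum>L\<in>pauli_symmetries \<G>. if q \<in> C then 1 / (real (card C))\<^sup>2 else 0)"
    proof (rule sum.cong[OF refl])
      fix L assume L: "L \<in> pauli_symmetries \<G>"
      then have LP: "L \<in> ?P" by (simp add: pauli_symmetries_def)
      have "haar_coeff p (p ** L) q q' = (if q \<in> C then trace (q ** L ** q') / 2 ^ CARD('n) else 0) / of_nat (card C)" for q'
        using haar_coeff_symmetry[OF p L q, of q'] card
        by (simp only: C_def[symmetric] nonzero_eq_divide_eq of_nat_eq_0_iff mult.commute not_False_eq_True)
      then have "(\<Sum>q'\<in>?P. (cmod (haar_coeff p (p ** L) q q'))\<^sup>2)
          = (\<Sum>q'\<in>?P. if q \<in> C then (cmod (trace (q ** L ** q') / 2 ^ CARD('n)))\<^sup>2 / (real (card C))\<^sup>2 else 0)"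
        by (intro sum.cong refl) (simp add: norm_divide power_divide)
      then show "(\<Sum>q'\<in>?P. (cmod (haar_coeff p (p ** L) q q'))\<^sup>2) = (if q \<in> C then 1 / (real (card C))\<^sup>2 else 0)"
        using sum_norm_trace_pauli[OF q LP] by (simp add: sum_divide_distrib[symmetric])
    qed
    finally show "(\<Sum>L\<in>?P. \<Sum>q'\<in>?P. (cmod (haar_coeff p (p ** L) q q'))\<^sup>2)
        = (\<Sum>L\<in>pauli_symmetries \<G>. if q \<in> C then 1 / (real (card C))\<^sup>2 else 0)" .
  qed
  also have "\<dots> = real (card (pauli_symmetries \<G>)) * (\<Sum>q\<in>?P. if q \<in> C then 1 / (real (card C))\<^sup>2 else 0)"
    by (simp add: sum_distrib_left)
  also have "(\<Sum>q\<in>?P. if q \<in> C then 1 / (real (card C))\<^sup>2 else 0) = 1 / real (card C)"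
    using CP card by (simp add: sum.If_cases Int_absorb1 Int_absorb2 power2_eq_square)
  finally show ?thesis by (simp add: C_def)
qed

lemma frame_potential_pauli:
  "frame_potential 2 \<mu> = real (card (isolated_vertices \<G>) * card (connected_components \<G>))"
proof -
  have "frame_potential 2 \<mu>
      = (\<Sum>p\<in>pauli_strings. real (card (pauli_symmetries \<G>)) * (1 / real (card (same_component \<G> `` {p}))))"
    unfolding frame_potential_eq_sum by (intro sum.cong refl) (simp add: sum_haar_coeff_fibre)
  also have "\<dots> = real (card (pauli_symmetries \<G>)) * real (card (connected_components \<G>))"
    unfolding sum_distrib_left[symmetric] sum_inverse_card_component[OF gen] ..
  finally show ?thesis
    by (simp add: card_isolated_vertices[OF gen])
qed

end

theorem proposition1:
  fixes \<G> :: "'n::finite operator set" and \<mu> :: "'n operator measure"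
  assumes "\<G> \<subseteq> pauli_strings"
    and "haar_probability (dynamical_lie_group \<G>) \<mu>"
    and "has_real_pauli_basis (dynamical_lie_algebra \<G>)"
    and "has_complex_pauli_basis (linear_symmetries (dynamical_lie_group \<G>))"
  shows "frame_potential 2 \<mu> =
    real (card (isolated_vertices \<G>) * card (connected_components \<G>))"
  using assms(1,2) by (rule frame_potential_pauli)

end
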